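(* Let $k_0$ be a fragmentation kernel which either has a non zero absolutely continuous part, or is a discrete singular measure whose support does not contain $1$ and does not satisfy Condition H. Let $u_0:(0,\infty)\to[0,\infty)$ satisfy $\int_0^\infty u_0(x)(1+x)\,dx<\infty$, let $p_0,q_0$ be the exponents associated with $u_0$, and assume that for all $\nu\in(p_0,q_0)$: $$\int_0^\infty |u_0'(x)|x^\nu dx<\infty,\quad \lim_{x\to0}x^\nu u_0(x)=\lim_{x\to\infty}x^\nu u_0(x)=0,$$ $$\int_0^\infty |u_0''(x)|x^{1+\nu}dx<\infty,\quad \lim_{x\to0}x^{1+\nu}u_0'(x)=\lim_{x\to\infty}x^{1+\nu}u_0'(x)=0.$$ If $q_0<\infty$, assume that there exist $a_0>0$, $r>q_0$, $C_1,C_2>0$ such that $$|u_0(x)-a_0x^{-q_0}|\le C_1x^{-r},\quad |u_0'(x)+a_0q_0x^{-q_0-1}|\le C_2x^{-r-1}\quad\forall x>1,$$ $$\int_1^\infty x^{\nu+1}|u_0''(x)-a_0q_0(q_0+1)x^{-q_0-2}|dx<\infty\quad\forall\nu\in(q_0,r).$$ If $p_0>-\infty$, assume that there exist $b_0>0$, $\rho<p_0$, $C_1',C_2'>0$ such that $$|u_0(x)-b_0x^{-p_0}|\le C_1'x^{-\rho},\quad |u_0'(x)+b_0p_0x^{-p_0-1}|\le C_2'x^{-\rho-1}\quad\forall x\in(0,1),$$ $$\int_0^1x^{\nu+1}|u_0''(x)-b_0p_0(p_0+1)x^{-p_0-2}|dx<\infty\quad\forall\nu\in(\rho,p_0).$$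 Let $u$ be the solution of the fragmentation equation with initial datum $u_0$, let $y_0=K'(2)$, $\sigma^2=K''(2)$ with $\sigma>0$, and define for all $t>0$ and $y,z\in\mathbb R$ $$r(t,y)=t\,e^{2ty}u(t,e^{ty}),\qquad\tilde r(t,z)=r\left(t,y_0+\frac{\sigma z}{\sqrt t}\right)\frac{\sigma}{\sqrt t}.$$ Then, as $t\to\infty$, $r(t,\cdot)\rightharpoonup U_0(2)\,\delta_{K'(2)}$ and $\tilde r(t,\cdot)\rightharpoonup U_0(2)\,G$ with $G(z)=\frac{e^{-z^2/2}}{\sqrt{2\pi}}$, in the weak sense of measures: for any bounded continuous function $\phi$ on $\mathbb R$, $$\int_{-\infty}^{+\infty}\phi(y)r(t,y)dy\to U_0(2)\phi(K'(2))\quad\text{and}\quad\int_{-\infty}^{+\infty}\phi(z)\tilde r(t,z)dz\to U_0(2)\int_{-\infty}^{+\infty}\phi(z)\frac{e^{-z^2/2}}{\sqrt{2\pi}}dz,$$ where $U_0(2)=\int_0^\infty xu_0(x)dx$ is the initial mass.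
   Context: A fragmentation kernel is a finite nonnegative measure $k_0$ with support contained in $[0,1]$ (written $k_0(z)dz$; integrals $\int_0^1$ against it are over $(0,1]$) such that $\int_0^1 z\,k_0(z)dz=1$ and $\int_0^1k_0(z)dz>1$. Its Mellin transform is $K(s)=\int_0^1 z^{s-1}k_0(z)dz$. Condition H: a subset $\Sigma$ of $(0,1)$ satisfies Condition H if there exist $\theta\in(0,1)$ and a finite (possibly one-term) or infinite strictly increasing sequence of positive integers $(p_\ell)_\ell$, setwise coprime, such that $\Sigma=\{\sigma_\ell:\sigma_\ell=\theta^{p_\ell}\}$. (The support of a discrete measure is understood here as the set of its atoms.) The fragmentation equation is $$\partial_t u(t,x)+u(t,x)=\int_x^\infty\frac1y k_0\left(\frac xy\right)u(t,y)\,dy,\qquad u(0,x)=u_0(x),\qquad t>0,\ x>0,$$ where for a measure $k_0$ the right-hand side means $\int_{(0,1]}u(t,x/z)\,z^{-1}k_0(dz)$. For the initial datum $u_0$: $U_0(s)=\int_0^\infty x^{s-1}u_0(x)dx$, $I(u_0)=\{p\in\mathbb R:\int_0^\infty u_0(x)x^{p-1}dx<\infty\}$ (an interval containing $[1,2]$), $p_0=\inf I(u_0)\in[-\infty,1]$, $q_0=\sup I(u_0)\in[2,+\infty]$. "The solution $u$" is the unique function in $C([0,\infty);L^1((1+x)dx))\cap C^1((0,\infty);L^1((1+x)dx))$ satisfying the equation and initial condition for all $t>0$ and almost every $x>0$; it is given by $u(t,x)=\frac1{2\pi i}\int_{\nu-i\infty}^{\nu+i\infty}U_0(s)e^{(K(s)-1)t}x^{-s}ds$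 for $\nu\in(1,2)$. *)

theory Defs
  imports "HOL-Analysis.Analysis"
begin

section \<open>Fragmentation kernels\<close>

text \<open>A kernel is a Borel measure on the whole real line that gives no mass to the complement of
  \<open>{0..1}\<close>; integrals against it are taken over \<open>{0<..1}\<close>, so a possible atom at \<open>0\<close> plays no
  role in them.\<close>

definition fragmentation_kernel :: "real measure \<Rightarrow> bool" where
  "fragmentation_kernel k \<longleftrightarrow>
     sets k = sets borel \<and> finite_measure k \<and> emeasure k (- {0..1}) = 0 \<and>
     (LINT z:{0<..1}|k. z) = 1 \<and> (LINT z:{0<..1}|k. 1::real) > 1"

text \<open>Both Mellin transforms are taken at real arguments; this suffices for the values and the
  derivatives at \<open>2\<close>.\<close>

definition kernel_mellin :: "real measure \<Rightarrow> real \<Rightarrow> real" where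
  "kernel_mellin k s = (LINT z:{0<..1}|k. z powr (s - 1))"

definition mutually_singular :: "'a measure \<Rightarrow> 'a measure \<Rightarrow> bool" where
  "mutually_singular M N \<longleftrightarrow>
     sets M = sets N \<and> (\<exists>A\<in>sets M. emeasure M A = 0 \<and> emeasure N (space N - A) = 0)"

definition lebesgue_decomposition :: "real measure \<Rightarrow> real measure \<Rightarrow> real measure \<Rightarrow> bool" where
  "lebesgue_decomposition k kac ks \<longleftrightarrow>
     sets kac = sets borel \<and> sets ks = sets borel \<and>
     absolutely_continuous lborel kac \<and> mutually_singular lborel ks \<and>
     (\<forall>A\<in>sets borel. emeasure k A = emeasure kac A + emeasure ks A)"

definition has_nonzero_ac_part :: "real measure \<Rightarrow> bool" where
  "has_nonzero_ac_part k \<longleftrightarrow>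
     (\<exists>kac ks. lebesgue_decomposition k kac ks \<and> emeasure kac UNIV \<noteq> 0)"

definition discrete_measure :: "real measure \<Rightarrow> bool" where
  "discrete_measure k \<longleftrightarrow> (\<exists>C. countable C \<and> emeasure k (- C) = 0)"

definition atoms :: "real measure \<Rightarrow> real set" where
  "atoms k = {x. emeasure k {x} \<noteq> 0}"

text \<open>The index set \<open>I\<close> makes the sequence either infinite or finite and nonempty. Setwise coprime
  means that the greatest common divisor of all the exponents together is \<open>1\<close>.\<close>

definition condition_H :: "real set \<Rightarrow> bool" where
  "condition_H \<Sigma> \<longleftrightarrow>
     \<Sigma> \<subseteq> {0<..<1} \<and>
     (\<exists>\<theta>\<in>{0<..<1}. \<exists>(I::nat set) (p::nat \<Rightarrow> nat).
        (I = UNIV \<or> (\<exists>n>0. I = {..<n})) \<and> strict_mono_on I p \<and> (\<forall>l\<in>I. p l > 0) \<and>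
        Gcd (p ` I) = 1 \<and> \<Sigma> = (\<lambda>l. \<theta> ^ p l) ` I)"

section \<open>Solutions of the fragmentation equation\<close>

text \<open>The space \<open>L\<^sup>1((1+x)dx)\<close> on the half-line, through Borel representatives. Borel (rather
  than Lebesgue) measurability is needed for the integral of \<open>u t (x / z)\<close> against an arbitrary
  Borel measure \<open>k\<close> to make sense.\<close>

definition in_L1w :: "(real \<Rightarrow> real) \<Rightarrow> bool" where
  "in_L1w f \<longleftrightarrow> set_integrable lborel {0<..} (\<lambda>x. f x * (1 + x))"

definition norm_L1w :: "(real \<Rightarrow> real) \<Rightarrow> real" where
  "norm_L1w f = (LBINT x:{0<..}. \<bar>f x\<bar> * (1 + x))"

definition continuous_L1w :: "real set \<Rightarrow> (real \<Rightarrow> real \<Rightarrow> real) \<Rightarrow> bool" where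
  "continuous_L1w T u \<longleftrightarrow>
     (\<forall>t\<in>T. in_L1w (u t)) \<and>
     (\<forall>t\<in>T. ((\<lambda>s. norm_L1w (\<lambda>x. u s x - u t x)) \<longlongrightarrow> 0) (at t within T))"

definition has_deriv_L1w ::
    "real set \<Rightarrow> (real \<Rightarrow> real \<Rightarrow> real) \<Rightarrow> (real \<Rightarrow> real \<Rightarrow> real) \<Rightarrow> bool" where
  "has_deriv_L1w T u v \<longleftrightarrow>
     (\<forall>t\<in>T. ((\<lambda>s. norm_L1w (\<lambda>x. (u s x - u t x) / (s - t) - v t x)) \<longlongrightarrow> 0) (at t within T))"

text \<open>The time derivative in the equation is the \<open>L\<^sup>1((1+x)dx)\<close>-valued derivative \<open>v\<close> of \<open>u\<close>.\<close>

definition fragmentation_solution ::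
    "real measure \<Rightarrow> (real \<Rightarrow> real) \<Rightarrow> (real \<Rightarrow> real \<Rightarrow> real) \<Rightarrow> bool" where
  "fragmentation_solution k u0 u \<longleftrightarrow>
     continuous_L1w {0..} u \<and>
     (AE x in lborel. x > 0 \<longrightarrow> u 0 x = u0 x) \<and>
     (\<exists>v. continuous_L1w {0<..} v \<and> has_deriv_L1w {0<..} u v \<and>
        (\<forall>t>0. AE x in lborel. x > 0 \<longrightarrow>
            v t x + u t x = (LINT z:{0<..1}|k. u t (x / z) / z)))"

section \<open>Initial data\<close>

definition mellin :: "(real \<Rightarrow> real) \<Rightarrow> real \<Rightarrow> real" where
  "mellin f s = (LBINT x:{0<..}. x powr (s - 1) * f x)"

definition mellin_exponents :: "(real \<Rightarrow> real) \<Rightarrow> real set" where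
  "mellin_exponents f = {p. set_integrable lborel {0<..} (\<lambda>x. f x * x powr (p - 1))}"

definition lower_exponent :: "(real \<Rightarrow> real) \<Rightarrow> ereal" where
  "lower_exponent f = (INF p\<in>mellin_exponents f. ereal p)"

definition upper_exponent :: "(real \<Rightarrow> real) \<Rightarrow> ereal" where
  "upper_exponent f = (SUP p\<in>mellin_exponents f. ereal p)"

text \<open>\<open>f\<close> is locally absolutely continuous on the half-line with derivative \<open>f'\<close>. This is the
  regularity under which the integral conditions on \<open>u0'\<close> and \<open>u0''\<close> make sense; it holds in
  particular for a differentiable \<open>f\<close> whose pointwise derivative \<open>f'\<close> is locally integrable.\<close>

definition loc_abs_cont_deriv :: "(real \<Rightarrow> real) \<Rightarrow> (real \<Rightarrow> real) \<Rightarrow> bool" where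
  "loc_abs_cont_deriv f f' \<longleftrightarrow>
     (\<forall>a b. 0 < a \<and> a \<le> b \<longrightarrow>
        set_integrable lborel {a..b} f' \<and> (LBINT x:{a..b}. f' x) = f b - f a)"

section \<open>Rescaled solutions\<close>

definition rescaled :: "(real \<Rightarrow> real \<Rightarrow> real) \<Rightarrow> real \<Rightarrow> real \<Rightarrow> real" where
  "rescaled u t y = t * exp (2 * t * y) * u t (exp (t * y))"

definition rescaled_gauss ::
    "(real \<Rightarrow> real \<Rightarrow> real) \<Rightarrow> real \<Rightarrow> real \<Rightarrow> real \<Rightarrow> real \<Rightarrow> real" where
  "rescaled_gauss u y0 \<sigma> t z = rescaled u t (y0 + \<sigma> * z / sqrt t) * (\<sigma> / sqrt t)"

end

theory Submission
  imports Defs "HOL-Probability.Probability"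
begin

text \<open>In logarithmic size \<open>x\<close>, the mass density of the solution is \<open>f t x = exp (2x) u(t, exp x)\<close>. The push-forward
\<open>Q\<close> of the measure \<open>z k\<^sub>0(dz)\<close> on \<open>(0, 1]\<close> under the logarithm is a probability measure, because
\<open>\<integral> z k\<^sub>0(dz) = 1\<close>, and the fragmentation equation becomes \<open>\<partial>\<^sub>t f = Q * f - f\<close> in \<open>L\<^sup>1(\<real>)\<close>. So
\<open>f t\<close> is the law at time \<open>t\<close>, up to the total mass, of a compound Poisson process with unit jump rate and
jump law \<open>Q\<close>, started from the density \<open>f 0\<close>. The two limits are the law of large numbers and
the central limit theorem for this process, since its mean drift \<open>\<integral> x dQ\<close> is \<open>K'(2)\<close> and its variance
rate \<open>\<integral> x\<^sup>2 dQ\<close> is \<open>K''(2)\<close>.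

The process itself is never constructed. The Fourier transform of \<open>f t\<close> solves the scalar equation
\<open>F' = (\<chi> - 1) F\<close>, where \<open>\<chi>\<close> is the characteristic function of \<open>Q\<close>, so that
\<open>F t = exp (t (\<chi> - 1)) F 0\<close> (\<open>fourier_flow\<close>). Positivity is preserved (\<open>nonneg_flow\<close>): in
\<open>f (t + h) = (1 - h) f t + h (Q * f t) + o(h)\<close> the main term is, for \<open>h < 1\<close>, a convex combination of \<open>f t\<close> and an
average of its translates, so the \<open>L\<^sup>1\<close> norm of the negative part cannot
grow. Hence the \<open>f t\<close> are densities of positive measures of constant mass, and Levy's continuity theorem
reduces weak convergence to pointwise convergence of Fourier transforms
(\<open>weak_limit_of_densities\<close>).

With \<open>m = \<integral> x dQ\<close>, the quadratic expansion of \<open>\<chi>\<close> at \<open>0\<close> gives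
\<open>t (\<chi>(\<xi>/t) - 1) \<longlongrightarrow> i\<xi>m\<close> (\<open>law_of_large_numbers\<close>) and, after centring,
\<open>t (\<chi>(\<xi>/(\<sigma>\<surd>t)) - 1) - i\<xi>m\<surd>t/\<sigma> \<longlongrightarrow> -\<xi>\<^sup>2/2\<close> (\<open>central_limit\<close>). All moments of \<open>Q\<close> are finite because
\<open>z \<bar>ln z\<bar>\<^sup>n\<close> is bounded on \<open>(0, 1]\<close>; moreover \<open>K(s)\<close> is the integral of \<open>exp ((s - 2) x)\<close> against \<open>Q\<close>, which
identifies the derivatives of \<open>K\<close> at \<open>2\<close> with the moments of \<open>Q\<close>.\<close>

section \<open>Convolution of an integrable function with a probability law\<close>

definition convolution :: "real measure \<Rightarrow> (real \<Rightarrow> real) \<Rightarrow> real \<Rightarrow> real" where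
  "convolution Q f x = (LINT y|Q. f (x - y))"

context real_distribution
begin

lemma sets_eq_borel' [measurable_cong]: "sets M = sets borel"
  by simp

text \<open>By translation invariance of Lebesgue measure every section in \<open>x\<close> has the same \<open>L\<^sup>1\<close> norm, so
Tonelli bounds the double integral by \<open>B \<parallel>f\<parallel>\<^sub>1\<close>..\<close>
lemma integrable_pair_translate:
  fixes g :: "real \<Rightarrow> complex" and f :: "real \<Rightarrow> real"
  assumes f: "integrable lborel f" and [measurable]: "g \<in> borel_measurable borel"
    and g: "\<And>x. norm (g x) \<le> B"
  shows "integrable (lborel \<Otimes>\<^sub>M M) (\<lambda>(x, y). g x * f (x - y))"
proof (rule integrableI_bounded)
  interpret P: pair_sigma_finite lborel M
    by (intro pair_sigma_finite.intro lborel.sigma_finite_measure_axioms sigma_finite_measure_axioms)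
  have [measurable]: "f \<in> borel_measurable borel" using f by auto
  show "(\<lambda>(x, y). g x * f (x - y)) \<in> borel_measurable (lborel \<Otimes>\<^sub>M M)" by measurable
  have B: "0 \<le> B" using g[of 0] norm_ge_zero by (rule order_trans[rotated])
  have "(\<integral>\<^sup>+ p. norm (case p of (x, y) \<Rightarrow> g x * f (x - y)) \<partial>(lborel \<Otimes>\<^sub>M M))
      \<le> (\<integral>\<^sup>+ p. (case p of (x, y) \<Rightarrow> ennreal B * ennreal \<bar>f (x - y)\<bar>) \<partial>(lborel \<Otimes>\<^sub>M M))"
    using B by (intro nn_integral_mono)
      (auto simp: norm_mult ennreal_mult[symmetric] intro!: ennreal_leI mult_right_mono g)
  also have "\<dots> = (\<integral>\<^sup>+ y. (\<integral>\<^sup>+ x. ennreal B * ennreal \<bar>f (x - y)\<bar> \<partial>lborel) \<partial>M)"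
    by (subst P.nn_integral_snd[symmetric]) auto
  also have "\<dots> = (\<integral>\<^sup>+ y. ennreal B * (\<integral>\<^sup>+ x. ennreal \<bar>f x\<bar> \<partial>lborel) \<partial>M)"
  proof (intro nn_integral_cong)
    fix y
    have "(\<integral>\<^sup>+ x. ennreal \<bar>f x\<bar> \<partial>lborel) = (\<integral>\<^sup>+ x. ennreal \<bar>f (x - y)\<bar> \<partial>lborel)"
      using nn_integral_real_affine[of "\<lambda>x. ennreal \<bar>f x\<bar>" 1 "-y"] by simp
    then show "(\<integral>\<^sup>+ x. ennreal B * ennreal \<bar>f (x - y)\<bar> \<partial>lborel)
      = ennreal B * (\<integral>\<^sup>+ x. ennreal \<bar>f x\<bar> \<partial>lborel)"
      by (simp add: nn_integral_cmult)
  qed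
  also have "\<dots> = ennreal B * (\<integral>\<^sup>+ x. ennreal \<bar>f x\<bar> \<partial>lborel)"
    using emeasure_space_1 by simp
  also have "\<dots> < \<infinity>"
    using f by (auto simp: integrable_iff_bounded ennreal_mult_less_top)
  finally show "(\<integral>\<^sup>+ p. norm (case p of (x, y) \<Rightarrow> g x * f (x - y)) \<partial>(lborel \<Otimes>\<^sub>M M)) < \<infinity>" .
qed

lemma AE_integrable_translate:
  fixes f :: "real \<Rightarrow> real"
  assumes f: "integrable lborel f"
  shows "AE x in lborel. integrable M (\<lambda>y. f (x - y))"
proof -
  interpret P: pair_sigma_finite lborel M
    by (intro pair_sigma_finite.intro lborel.sigma_finite_measure_axioms sigma_finite_measure_axioms)
  have "integrable (lborel \<Otimes>\<^sub>M M) (\<lambda>(x, y). (1::complex) * f (x - y))"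
    using integrable_pair_translate[OF f, of "\<lambda>_. 1" 1] by auto
  from P.AE_integrable_fst'[OF this] show ?thesis by (simp add: complex_of_real_integrable_eq)
qed

lemma
  fixes g :: "real \<Rightarrow> complex" and f :: "real \<Rightarrow> real"
  assumes f: "integrable lborel f" and [measurable]: "g \<in> borel_measurable borel"
    and g: "\<And>x. norm (g x) \<le> B"
  shows integrable_convolution: "integrable lborel (\<lambda>x. g x * convolution M f x)" (is ?A)
    and integral_convolution: "(LINT x|lborel. g x * convolution M f x)
      = (LINT y|M. LINT x|lborel. g (x + y) * f x)" (is ?B)
proof -
  interpret P: pair_sigma_finite lborel M
    by (intro pair_sigma_finite.intro lborel.sigma_finite_measure_axioms sigma_finite_measure_axioms)
  note I = integrable_pair_translate[OF assms]
  have [measurable]: "f \<in> borel_measurable borel" using f by auto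
  have eq: "(LINT y|M. g x * f (x - y)) = g x * convolution M f x" for x
    by (simp add: convolution_def)
  show ?A using P.integrable_fst[OF I] by (simp only: eq split_conv)
  have "(LINT x|lborel. g x * convolution M f x) = (LINT x|lborel. LINT y|M. g x * f (x - y))"
    by (simp only: eq)
  also have "\<dots> = (LINT y|M. LINT x|lborel. g x * f (x - y))"
    using P.Fubini_integral[OF I] by simp
  also have "\<dots> = (LINT y|M. LINT x|lborel. g (x + y) * f x)"
  proof (rule Bochner_Integration.integral_cong)
    fix y
    show "(LINT x|lborel. g x * f (x - y)) = (LINT x|lborel. g (x + y) * f x)"
      using lborel_integral_real_affine[of 1 "\<lambda>x. g x * f (x - y)" y] by (simp add: add.commute)
  qed simp
  finally show ?B .
qed

lemma
  assumes f: "integrable lborel f"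
  shows integrable_convolution_real: "integrable lborel (convolution M f)" (is ?A)
    and integral_convolution_real: "(LINT x|lborel. convolution M f x) = (LINT x|lborel. f x)" (is ?B)
proof -
  show A: ?A using integrable_convolution[OF f, of "\<lambda>_. 1" 1]
    by (simp add: complex_of_real_integrable_eq)
  have "complex_of_real (LINT x|lborel. convolution M f x) = of_real (LINT x|lborel. f x)"
    using integral_convolution[OF f, of "\<lambda>_. 1" 1] prob_space by simp
  then show ?B by (simp only: of_real_eq_iff)
qed

lemma integral_iexp_convolution:
  assumes f: "integrable lborel f"
  shows "(LINT x|lborel. iexp (\<xi> * x) * convolution M f x)
      = char M \<xi> * (LINT x|lborel. iexp (\<xi> * x) * f x)"
proof -
  have "(LINT x|lborel. iexp (\<xi> * x) * convolution M f x)
      = (LINT y|M. LINT x|lborel. iexp (\<xi> * (x + y)) * f x)"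
    by (rule integral_convolution[OF f, where B=1]) auto
  also have "\<dots> = (LINT y|M. iexp (\<xi> * y) * (LINT x|lborel. iexp (\<xi> * x) * f x))"
  proof (rule Bochner_Integration.integral_cong[OF refl])
    fix y
    have "iexp (\<xi> * (x + y)) * f x = iexp (\<xi> * y) * (iexp (\<xi> * x) * f x)" for x
      by (simp add: distrib_left exp_add)
    then show "(LINT x|lborel. iexp (\<xi> * (x + y)) * f x)
        = iexp (\<xi> * y) * (LINT x|lborel. iexp (\<xi> * x) * f x)"
      by (simp only: integral_mult_right_zero)
  qed
  also have "\<dots> = char M \<xi> * (LINT x|lborel. iexp (\<xi> * x) * f x)"
    by (simp only: char_def integral_mult_left_zero)
  finally show ?thesis .
qed

end

section \<open>Positivity and Fourier transform of a convolution flow\<close>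

text \<open>For each \<open>\<epsilon> > 0\<close> the set of points where \<open>n\<close> lies on or below the line through \<open>(a, n a)\<close> of
slope \<open>\<epsilon>\<close> is compact. Its largest element must be \<open>b\<close>, since from a smaller one the condition on the right
yields a larger element of the set.\<close>
lemma no_growth_of_right_derivative_nonpos:
  fixes n :: "real \<Rightarrow> real"
  assumes ab: "a \<le> b" and cont: "continuous_on {a..b} n"
    and step: "\<And>t \<epsilon>. a \<le> t \<Longrightarrow> t < b \<Longrightarrow> \<epsilon> > 0 \<Longrightarrow> \<forall>\<^sub>F s in at_right t. n s \<le> n t + \<epsilon> * (s - t)"
  shows "n b \<le> n a"
proof (rule field_le_epsilon)
  fix e :: real assume e: "e > 0"
  \<comment> \<open>The summand \<open>1\<close> keeps the denominator positive when \<open>a = b\<close>.\<close>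
  define \<epsilon> where "\<epsilon> = e / (b - a + 1)"
  have \<epsilon>: "\<epsilon> > 0" using e ab by (simp add: \<epsilon>_def)
  define S where "S = {s\<in>{a..b}. n s \<le> n a + \<epsilon> * (s - a)}"
  have "closed S" unfolding S_def
    by (intro closed_Collect_le continuous_intros cont closed_atLeastAtMost continuous_on_closed_Collect_le)
  then have "compact S" unfolding S_def
    by (metis (no_types, lifting) bounded_closed_interval bounded_subset compact_eq_bounded_closed mem_Collect_eq subsetI)
  moreover have "a \<in> S" using ab by (simp add: S_def)
  ultimately obtain c where c: "c \<in> S" and max: "\<And>s. s \<in> S \<Longrightarrow> s \<le> c"
    using compact_attains_sup[of S] by blast
  have "c = b"
  proof (rule ccontr)
    assume "c \<noteq> b"
    with c have cb: "a \<le> c" "c < b" by (auto simp: S_def)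
    have "\<forall>\<^sub>F s in at_right c. n s \<le> n c + \<epsilon> * (s - c) \<and> c < s \<and> s < b"
      using step[OF cb \<epsilon>] cb by (intro eventually_conj eventually_at_right_less) (auto simp: eventually_at_right)
    then obtain s where s: "n s \<le> n c + \<epsilon> * (s - c)" "c < s" "s < b"
      using eventually_happens' trivial_limit_at_right_real by blast
    have "n s \<le> n a + \<epsilon> * (s - a)"
      using s(1) c by (auto simp: S_def algebra_simps)
    then have "s \<in> S" using s cb by (simp add: S_def)
    with max s show False by fastforce
  qed
  with c have "n b \<le> n a + \<epsilon> * (b - a)" by (simp add: S_def)
  also have "\<epsilon> * (b - a) \<le> e"
    unfolding \<epsilon>_def using e ab by (simp add: field_simps)
  finally show "n b \<le> n a + e" by simp
qed

text \<open>Solutions of \<open>\<partial>\<^sub>t f = Q * f - f\<close> in \<open>L\<^sup>1(\<real>)\<close>. The equation is only required for \<open>t > 0\<close>, so the initial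
value enters through continuity at \<open>0\<close> alone.\<close>
locale convolution_flow = real_distribution Q for Q :: "real measure" +
  fixes f :: "real \<Rightarrow> real \<Rightarrow> real"
  assumes integrable_flow: "t \<ge> 0 \<Longrightarrow> integrable lborel (f t)"
    and continuous_flow: "t \<ge> 0 \<Longrightarrow>
      ((\<lambda>s. LINT x|lborel. \<bar>f s x - f t x\<bar>) \<longlongrightarrow> 0) (at t within {0..})"
    and derivative_flow: "t > 0 \<Longrightarrow>
      ((\<lambda>s. LINT x|lborel. \<bar>(f s x - f t x) / (s - t) - (convolution Q (f t) x - f t x)\<bar>) \<longlongrightarrow> 0) (at t)"
    and initial_nonneg: "AE x in lborel. f 0 x \<ge> 0"
begin

lemma norm_integral_iexp_le:
  assumes "integrable lborel h"
  shows "norm (LINT x|lborel. iexp (\<xi> * x) * h x) \<le> (LINT x|lborel. \<bar>h x\<bar>)"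
proof -
  have "norm (LINT x|lborel. iexp (\<xi> * x) * h x) \<le> (LINT x|lborel. norm (iexp (\<xi> * x) * h x))"
    by (rule integral_norm_bound)
  then show ?thesis by (simp add: norm_mult)
qed

lemma integrable_iexp_mult:
  fixes h :: "real \<Rightarrow> real"
  assumes "integrable lborel h"
  shows "integrable lborel (\<lambda>x. iexp (\<xi> * x) * h x)"
proof -
  have "integrable lborel (\<lambda>x. complex_of_real (h x))" using assms by (simp add: complex_of_real_integrable_eq)
  then show ?thesis
    by (rule Bochner_Integration.integrable_bound) (use assms in \<open>auto simp: norm_mult\<close>)
qed

text \<open>The Fourier transform is a contraction from \<open>L\<^sup>1\<close> to bounded functions, so differentiability in \<open>L\<^sup>1\<close>
passes to it, and it turns the convolution with \<open>Q\<close> into multiplication by the characteristic function.\<close>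
lemma fourier_flow_has_derivative:
  assumes t: "t > 0"
  shows "((\<lambda>t. LINT x|lborel. iexp (\<xi> * x) * f t x) has_vector_derivative
    (char Q \<xi> - 1) * (LINT x|lborel. iexp (\<xi> * x) * f t x)) (at t)"
proof -
  define L where "L t = (LINT x|lborel. iexp (\<xi> * x) * f t x)" for t
  let ?D = "(char Q \<xi> - 1) * L t"
  define N where "N s = (LINT x|lborel. \<bar>(f s x - f t x) / (s - t) - (convolution Q (f t) x - f t x)\<bar>)" for s
  have ft: "integrable lborel (f t)" "integrable lborel (convolution Q (f t))"
    using t integrable_flow integrable_convolution_real[OF integrable_flow[of t]] by auto
  have D: "?D = (LINT x|lborel. iexp (\<xi> * x) * (convolution Q (f t) x - f t x))"
    using integral_iexp_convolution[OF ft(1), of \<xi>]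
      Bochner_Integration.integral_diff[OF integrable_iexp_mult[OF ft(2)] integrable_iexp_mult[OF ft(1)], of \<xi> \<xi>]
    by (simp add: left_diff_distrib right_diff_distrib L_def)
  have bound: "norm (L s - L t - (s - t) *\<^sub>R ?D) / norm (s - t) \<le> N s" if s: "s > 0" "s \<noteq> t" for s
  proof -
    have fs: "integrable lborel (f s)" using s by (auto intro: integrable_flow)
    have h: "integrable lborel (\<lambda>x. (f s x - f t x) / (s - t) - (convolution Q (f t) x - f t x))"
      using fs ft by auto
    have "(LINT x|lborel. iexp (\<xi> * x) * ((f s x - f t x) / (s - t) - (convolution Q (f t) x - f t x) :: real))
        = (LINT x|lborel. (iexp (\<xi> * x) * f s x - iexp (\<xi> * x) * f t x) / of_real (s - t) - iexp (\<xi> * x) * (convolution Q (f t) x - f t x))"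
      by (intro Bochner_Integration.integral_cong) (auto simp: field_simps diff_divide_distrib)
    also have "\<dots> = (L s - L t) / of_real (s - t) - ?D"
    proof -
      note E = integrable_iexp_mult[OF fs, of \<xi>] integrable_iexp_mult[OF ft(1), of \<xi>]
        integrable_iexp_mult[OF Bochner_Integration.integrable_diff[OF ft(2,1)], of \<xi>]
      have E12: "integrable lborel (\<lambda>x. (iexp (\<xi> * x) * f s x - iexp (\<xi> * x) * f t x) / of_real (s - t))"
        by (intro integrable_divide_zero Bochner_Integration.integrable_diff E impI)
      show ?thesis
        unfolding D using Bochner_Integration.integral_diff[OF E12 E(3)]
        by (simp only: L_def of_real_diff integral_divide_zero Bochner_Integration.integral_diff[OF E(1,2)])
    qed
    finally have "norm ((L s - L t) / of_real (s - t) - ?D) \<le> N s"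
      using norm_integral_iexp_le[OF h, of \<xi>] by (simp add: N_def)
    moreover have "(L s - L t) / of_real (s - t) - ?D = (L s - L t - (s - t) *\<^sub>R ?D) / of_real (s - t)"
      using s by (simp add: diff_divide_distrib scaleR_conv_of_real)
    ultimately show ?thesis by (simp add: norm_divide del: of_real_diff)
  qed
  have "((\<lambda>s. norm (L s - L t - (s - t) *\<^sub>R ?D) / norm (s - t)) \<longlongrightarrow> 0) (at t)"
  proof (rule Lim_null_comparison)
    show "(N \<longlongrightarrow> 0) (at t)" using derivative_flow[OF t] by (simp add: N_def[abs_def])
    have "\<forall>\<^sub>F s in at t. s > 0 \<and> s \<noteq> t"
      using t by (intro eventually_conj order_tendstoD[OF tendsto_ident_at]) (auto simp: eventually_at_filter)
    then show "\<forall>\<^sub>F s in at t. norm (norm (L s - L t - (s - t) *\<^sub>R ?D) / norm (s - t)) \<le> N s"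
      by eventually_elim (use bound in auto)
  qed
  then show ?thesis
    unfolding has_vector_derivative_def has_derivative_iff_norm L_def[symmetric]
    by (simp add: bounded_linear_scaleR_left)
qed

text \<open>Multiplying by the integrating factor makes the function constant on \<open>(0, t]\<close>; continuity in \<open>L\<^sup>1\<close>
extends this to \<open>0\<close>.\<close>
lemma fourier_flow:
  assumes t: "t \<ge> 0"
  shows "(LINT x|lborel. iexp (\<xi> * x) * f t x)
    = exp (t * (char Q \<xi> - 1)) * (LINT x|lborel. iexp (\<xi> * x) * f 0 x)"
proof -
  define L where "L t = (LINT x|lborel. iexp (\<xi> * x) * f t x)" for t
  define c where "c = char Q \<xi> - 1"
  define H where "H s = exp (s *\<^sub>R (- c)) * L s" for s
  have cont: "continuous_on {0..} L"
    unfolding continuous_on_def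
  proof (intro ballI)
    fix t :: real assume t: "t \<in> {0..}"
    have "((\<lambda>s. L s - L t) \<longlongrightarrow> 0) (at t within {0..})"
    proof (rule Lim_null_comparison)
      show "((\<lambda>s. LINT x|lborel. \<bar>f s x - f t x\<bar>) \<longlongrightarrow> 0) (at t within {0..})"
        using t continuous_flow by auto
      have "norm (L s - L t) \<le> (LINT x|lborel. \<bar>f s x - f t x\<bar>)" if s: "s \<ge> 0" for s
      proof -
        have "L s - L t = (LINT x|lborel. iexp (\<xi> * x) * (f s x - f t x))"
          unfolding L_def using s t
          using Bochner_Integration.integral_diff[OF integrable_iexp_mult[OF integrable_flow]
              integrable_iexp_mult[OF integrable_flow], of s t \<xi> \<xi>]
          by (simp add: right_diff_distrib)
        then show ?thesis using norm_integral_iexp_le[of "\<lambda>x. f s x - f t x" \<xi>] s t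
          by (auto simp: integrable_flow)
      qed
      then show "\<forall>\<^sub>F s in at t within {0..}. norm (L s - L t) \<le> (LINT x|lborel. \<bar>f s x - f t x\<bar>)"
        by (auto simp: eventually_at_filter)
    qed
    then show "(L \<longlongrightarrow> L t) (at t within {0..})" by (simp add: LIM_zero_iff)
  qed
  have "H t = H 0"
  proof (rule has_derivative_zero_unique_strong_interval[of "{0}" 0 t H])
    show "continuous_on {0..t} H"
      unfolding H_def by (intro continuous_intros continuous_on_subset[OF cont]) auto
    fix s assume s: "s \<in> {0..t} - {0}"
    then have "s > 0" by auto
    note L' = has_vector_derivative_at_within[OF fourier_flow_has_derivative[OF this, of \<xi>, folded L_def c_def],
      of "{0..t}"]
    have E: "((\<lambda>s. exp (s *\<^sub>R (-c))) has_vector_derivative (-c) * exp (s *\<^sub>R (-c))) (at s within {0..t})"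
      by (rule has_vector_derivative_at_within[OF exp_scaleR_has_vector_derivative_left])
    have zero: "E * (c * y) + (- c * E) * y = 0" for E y :: complex by (simp add: mult.left_commute)
    have "(H has_vector_derivative 0) (at s within {0..t})"
      using has_vector_derivative_mult[OF E L'] unfolding zero H_def[abs_def] .
    then show "(H has_derivative (\<lambda>h. 0)) (at s within {0..t})"
      by (simp add: has_vector_derivative_def)
  qed (use t in auto)
  then have H: "exp (- (t * c)) * L t = L 0" by (simp add: H_def scaleR_conv_of_real)
  have "L t = exp (t * c) * exp (- (t * c)) * L t" by (simp only: exp_minus_inverse mult_1)
  then have "L t = exp (t * c) * L 0" by (simp only: mult.assoc H)
  then show ?thesis by (simp add: L_def c_def)
qed

lemma integral_flow:
  assumes t: "t \<ge> 0"
  shows "(LINT x|lborel. f t x) = (LINT x|lborel. f 0 x)"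
proof -
  have "complex_of_real (LINT x|lborel. f t x) = of_real (LINT x|lborel. f 0 x)"
    using fourier_flow[OF t, of 0] by (simp add: char_zero)
  then show ?thesis by (simp only: of_real_eq_iff)
qed

text \<open>Write \<open>f\<^sup>-\<close> for the negative part. For \<open>0 < h < 1\<close>, the expansion
\<open>f (t + h) = (1 - h) f t + h (Q * f t) + h R\<close> with \<open>R \<longlongrightarrow> 0\<close> in \<open>L\<^sup>1\<close> gives
\<open>f\<^sup>- (t + h) \<le> (1 - h) f\<^sup>- t + h (Q * f\<^sup>- t) + h \<bar>R\<bar>\<close>. Convolution with \<open>Q\<close> preserves the integral, so
the integral of \<open>f\<^sup>-\<close> has nonpositive upper right derivative and stays at its initial value \<open>0\<close>.\<close>
lemma nonneg_flow:
  assumes t: "t \<ge> 0"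
  shows "AE x in lborel. f t x \<ge> 0"
proof -
  define neg where "neg t x = max 0 (- f t x)" for t x
  define n where "n t = (LINT x|lborel. neg t x)" for t
  have neg: "integrable lborel (neg t)" if "t \<ge> 0" for t
    unfolding neg_def[abs_def] using integrable_flow[OF that] by auto
  have cont: "continuous_on {0..} n"
    unfolding continuous_on_def
  proof (intro ballI)
    fix t :: real assume t: "t \<in> {0..}"
    have "((\<lambda>s. n s - n t) \<longlongrightarrow> 0) (at t within {0..})"
    proof (rule Lim_null_comparison)
      show "((\<lambda>s. LINT x|lborel. \<bar>f s x - f t x\<bar>) \<longlongrightarrow> 0) (at t within {0..})"
        using t continuous_flow by auto
      have "norm (n s - n t) \<le> (LINT x|lborel. \<bar>f s x - f t x\<bar>)" if s: "s \<ge> 0" for s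
      proof -
        have "norm (n s - n t) = norm (LINT x|lborel. neg s x - neg t x)"
          unfolding n_def using s t neg by simp
        also have "\<dots> \<le> (LINT x|lborel. norm (neg s x - neg t x))" by (rule integral_norm_bound)
        also have "\<dots> \<le> (LINT x|lborel. \<bar>f s x - f t x\<bar>)"
          using s t neg integrable_flow by (intro integral_mono) (auto simp: neg_def)
        finally show ?thesis .
      qed
      then show "\<forall>\<^sub>F s in at t within {0..}. norm (n s - n t) \<le> (LINT x|lborel. \<bar>f s x - f t x\<bar>)"
        by (auto simp: eventually_at_filter)
    qed
    then show "(n \<longlongrightarrow> n t) (at t within {0..})" by (simp add: LIM_zero_iff)
  qed
  have step: "\<forall>\<^sub>F s in at_right t. n s \<le> n t + \<epsilon> * (s - t)" if t: "t > 0" and \<epsilon>: "\<epsilon> > 0" for t \<epsilon>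
  proof -
    define R where "R s x = (f s x - f t x) / (s - t) - (convolution Q (f t) x - f t x)" for s x
    have ft: "integrable lborel (f t)" "integrable lborel (convolution Q (f t))"
      "integrable lborel (neg t)" "integrable lborel (convolution Q (neg t))"
      using t integrable_flow[of t] neg[of t] integrable_convolution_real[OF integrable_flow[of t]]
        integrable_convolution_real[OF neg[of t]] by auto
    have pos: "AE x in lborel. convolution Q (f t) x \<ge> - convolution Q (neg t) x"
      using AE_integrable_translate[OF ft(1)] AE_integrable_translate[OF ft(3)]
      by eventually_elim
        (auto simp: convolution_def neg_def simp flip: Bochner_Integration.integral_minus intro!: integral_mono)
    have main: "n s \<le> n t + \<epsilon> * (s - t)"
      if s: "t < s" "s < t + 1" and small: "(LINT x|lborel. \<bar>R s x\<bar>) < \<epsilon>" for s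
    proof -
      define h where "h = s - t"
      have h: "0 < h" "h < 1" using s by (auto simp: h_def)
      have R: "integrable lborel (R s)"
        unfolding R_def using s t ft integrable_flow[of s] by auto
      have "n s \<le> (LINT x|lborel. (1 - h) * neg t x + h * convolution Q (neg t) x + h * \<bar>R s x\<bar>)"
        unfolding n_def
      proof (rule integral_mono_AE)
        show "AE x in lborel. neg s x \<le> (1 - h) * neg t x + h * convolution Q (neg t) x + h * \<bar>R s x\<bar>"
          using pos
        proof eventually_elim
          fix x assume pos: "convolution Q (f t) x \<ge> - convolution Q (neg t) x"
          have "h * R s x = f s x - f t x - h * (convolution Q (f t) x - f t x)"
          proof -
            have "h * ((f s x - f t x) / h) = f s x - f t x" using h by simp
            then show ?thesis
              by (simp only: R_def h_def[symmetric] right_diff_distrib[of h "(f s x - f t x) / h"])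
          qed
          then have "- f s x = (1 - h) * (- f t x) - h * convolution Q (f t) x - h * R s x"
            by (simp add: algebra_simps)
          also have "\<dots> \<le> (1 - h) * neg t x + h * convolution Q (neg t) x + h * \<bar>R s x\<bar>"
          proof -
            have "(1 - h) * (- f t x) \<le> (1 - h) * neg t x" using h by (intro mult_left_mono) (auto simp: neg_def)
            moreover have "h * (- convolution Q (neg t) x) \<le> h * convolution Q (f t) x"
              using h pos by (intro mult_left_mono) auto
            moreover have "h * (- R s x) \<le> h * \<bar>R s x\<bar>" using h by (intro mult_left_mono) auto
            ultimately show ?thesis by simp
          qed
          finally have 1: "- f s x \<le> \<dots>" .
          have "0 \<le> convolution Q (neg t) x"
            unfolding convolution_def by (intro integral_nonneg_AE) (auto simp: neg_def)
          then have 2: "0 \<le> (1 - h) * neg t x + h * convolution Q (neg t) x + h * \<bar>R s x\<bar>"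
            using h by (auto simp: neg_def)
          show "neg s x \<le> (1 - h) * neg t x + h * convolution Q (neg t) x + h * \<bar>R s x\<bar>"
            unfolding neg_def[of s] using 1 2 by simp
        qed
      qed (use ft R neg s t in auto)
      also have "\<dots> = (1 - h) * n t + h * n t + h * (LINT x|lborel. \<bar>R s x\<bar>)"
      proof -
        have i: "integrable lborel (\<lambda>x. (1 - h) * neg t x)" "integrable lborel (\<lambda>x. h * convolution Q (neg t) x)"
          "integrable lborel (\<lambda>x. h * \<bar>R s x\<bar>)"
          by (rule integrable_mult_right, rule ft, rule integrable_mult_right, rule ft,
              rule integrable_mult_right, rule integrable_abs, rule R)
        show ?thesis
          unfolding Bochner_Integration.integral_add[OF Bochner_Integration.integrable_add[OF i(1,2)] i(3)]
            Bochner_Integration.integral_add[OF i(1,2)]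
          by (simp only: integral_mult_right_zero integral_convolution_real[OF ft(3)] n_def)
      qed
      also have "\<dots> \<le> (1 - h) * n t + h * n t + h * \<epsilon>"
        using small h by (intro add_left_mono mult_left_mono) auto
      also have "\<dots> = n t + \<epsilon> * (s - t)"
        by (simp add: h_def algebra_simps)
      finally show ?thesis .
    qed
    have "\<forall>\<^sub>F s in at_right t. (LINT x|lborel. \<bar>R s x\<bar>) < \<epsilon>"
      using order_tendstoD(2)[OF derivative_flow[OF t] \<epsilon>] unfolding R_def
      by (auto simp: eventually_at_split)
    moreover have "\<forall>\<^sub>F s in at_right t. t < s \<and> s < t + 1"
      by (intro eventually_at_rightI[of t "t + 1"]) auto
    ultimately show ?thesis by eventually_elim (use main in auto)
  qed
  have n0: "n 0 = 0"
    unfolding n_def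
  proof (rule integral_eq_zero_AE)
    show "AE x in lborel. neg 0 x = 0"
      using initial_nonneg by eventually_elim (simp add: neg_def)
  qed
  \<comment> \<open>The one-sided estimate is available at positive times only, so \<open>n t \<le> n s\<close> is shown for \<open>0 < s\<close> and then \<open>s\<close> tends to \<open>0\<close>.\<close>
  have le: "n t \<le> n s" if s: "0 < s" "s \<le> t" for s
  proof (rule no_growth_of_right_derivative_nonpos[OF s(2)])
    show "continuous_on {s..t} n"
      by (rule continuous_on_subset[OF cont]) (use s in auto)
    fix r \<epsilon> :: real assume "s \<le> r" "\<epsilon> > 0"
    then show "\<forall>\<^sub>F q in at_right r. n q \<le> n r + \<epsilon> * (q - r)"
      using s by (intro step) auto
  qed
  have "n t \<le> 0"
  proof (cases "t = 0")
    case False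
    have "(n \<longlongrightarrow> n 0) (at 0 within {0..})" using cont by (auto simp: continuous_on_def)
    moreover have "{0<..} \<subseteq> {0::real..}" by auto
    ultimately have lim: "(n \<longlongrightarrow> n 0) (at_right 0)" by (rule tendsto_within_subset)
    have "\<forall>\<^sub>F s in at_right 0. n t \<le> n s"
      by (rule eventually_at_rightI[of 0 t]) (use False t le in auto)
    from tendsto_lowerbound[OF lim this] show ?thesis using n0 by simp
  qed (use n0 in simp)
  moreover have "n t \<ge> 0" unfolding n_def by (intro integral_nonneg_AE) (auto simp: neg_def)
  ultimately have "n t = 0" by simp
  then have "AE x in lborel. neg t x = 0"
    unfolding n_def by (subst (asm) integral_nonneg_eq_0_iff_AE[OF neg[OF t]]) (auto simp: neg_def)
  then show ?thesis by eventually_elim (simp add: neg_def max_def split: if_splits)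
qed

end

section \<open>Laws with exponential moments\<close>

lemma power_le_fact_mult_exp:
  fixes y :: real
  assumes "y \<ge> 0"
  shows "y ^ n \<le> fact n * exp y"
proof -
  have "y ^ n / fact n \<le> (\<Sum>k\<le>n. y ^ k / fact k)"
    using assms by (intro member_le_sum) auto
  also have "\<dots> \<le> exp y"
  proof -
    have "(\<Sum>k\<le>n. inverse (fact k) * y ^ k) \<le> (\<Sum>k. inverse (fact k) * y ^ k)"
      using assms by (intro sum_le_suminf summable_exp) auto
    then show ?thesis by (simp add: exp_def divide_inverse mult.commute)
  qed
  finally show ?thesis by (simp add: field_simps)
qed

text \<open>A remainder bound with an explicit square lets differentiation under the integral sign be read off a single
inequality between integrals.\<close>
lemma has_field_derivative_of_quadratic_error:
  fixes G :: "real \<Rightarrow> real"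
  assumes d: "d > 0" and err: "\<And>h. \<bar>h\<bar> < d \<Longrightarrow> \<bar>G (s + h) - G s - h * D\<bar> \<le> C * h\<^sup>2"
  shows "(G has_real_derivative D) (at s)"
  unfolding DERIV_def
proof (rule LIM_zero_cancel, rule Lim_null_comparison)
  show "((\<lambda>h. C * \<bar>h\<bar>) \<longlongrightarrow> 0) (at 0)" by (auto intro!: tendsto_eq_intros)
  have "\<forall>\<^sub>F h in at (0::real). \<bar>h\<bar> < d \<and> h \<noteq> 0"
    using d by (auto simp: eventually_at dist_real_def)
  then show "\<forall>\<^sub>F h in at 0. norm ((G (s + h) - G s) / h - D) \<le> C * \<bar>h\<bar>"
  proof eventually_elim
    fix h assume h: "\<bar>h\<bar> < d \<and> h \<noteq> 0"
    then have "norm ((G (s + h) - G s) / h - D) = \<bar>G (s + h) - G s - h * D\<bar> / \<bar>h\<bar>"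
    proof -
      have "(G (s + h) - G s) / h - D = (G (s + h) - G s - h * D) / h"
        using h by (simp add: field_simps)
      then show ?thesis by (simp only: real_norm_def abs_divide)
    qed
    also have "\<dots> \<le> C * h\<^sup>2 / \<bar>h\<bar>" using h err by (intro divide_right_mono) auto
    also have "C * h\<^sup>2 = C * \<bar>h\<bar> * \<bar>h\<bar>" by (simp add: power2_eq_square)
    also have "C * \<bar>h\<bar> * \<bar>h\<bar> / \<bar>h\<bar> = C * \<bar>h\<bar>"
      using h by (intro nonzero_mult_div_cancel_right) auto
    finally show "norm ((G (s + h) - G s) / h - D) \<le> C * \<bar>h\<bar>" .
  qed
qed

locale real_distribution_exp_moments = real_distribution +
  fixes \<delta> :: real
  assumes delta_pos: "\<delta> > 0"
    and integrable_exp_moment: "integrable M (\<lambda>x. \<bar>x\<bar> ^ n * exp (\<delta> * \<bar>x\<bar>))"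
begin

lemma integrable_power_exp:
  assumes "\<bar>s\<bar> \<le> \<delta>"
  shows "integrable M (\<lambda>x. x ^ n * exp (s * x))"
proof (rule Bochner_Integration.integrable_bound[OF integrable_exp_moment[of n]])
  show "AE x in M. norm (x ^ n * exp (s * x)) \<le> norm (\<bar>x\<bar> ^ n * exp (\<delta> * \<bar>x\<bar>))"
  proof (intro AE_I2)
    fix x
    have "s * x \<le> \<bar>s\<bar> * \<bar>x\<bar>" by (metis abs_ge_self abs_mult)
    also have "\<dots> \<le> \<delta> * \<bar>x\<bar>" using assms by (intro mult_right_mono) auto
    finally have "s * x \<le> \<delta> * \<bar>x\<bar>" .
    then show "norm (x ^ n * exp (s * x)) \<le> norm (\<bar>x\<bar> ^ n * exp (\<delta> * \<bar>x\<bar>))"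
      by (simp add: abs_mult power_abs mult_left_mono)
  qed
qed simp

lemma integrable_moment: "integrable M (\<lambda>x. x ^ n)"
  using integrable_power_exp[of 0 n] delta_pos by simp

text \<open>The remainder of the first-order Taylor polynomial of \<open>exp (h x)\<close> is at most \<open>(h x)\<^sup>2 exp \<bar>h x\<bar>\<close>, and for small \<open>h\<close> the exponent
\<open>s x + \<bar>h x\<bar>\<close> stays below \<open>\<delta> \<bar>x\<bar>\<close>, which leaves an integrable bound independent of \<open>h\<close>.\<close>
lemma DERIV_exp_moment:
  assumes s: "\<bar>s\<bar> < \<delta>"
  shows "((\<lambda>s. LINT x|M. x ^ n * exp (s * x)) has_real_derivative
    (LINT x|M. x ^ Suc n * exp (s * x))) (at s)"
proof (rule has_field_derivative_of_quadratic_error)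
  show "\<delta> - \<bar>s\<bar> > 0" using s by simp
  fix h assume h: "\<bar>h\<bar> < \<delta> - \<bar>s\<bar>"
  have int: "integrable M (\<lambda>x. x ^ n * exp ((s + h) * x))" "integrable M (\<lambda>x. x ^ n * exp (s * x))"
    "integrable M (\<lambda>x. x ^ Suc n * exp (s * x))"
    using h s by (intro integrable_power_exp; linarith)+
  have "\<bar>(LINT x|M. x ^ n * exp ((s + h) * x)) - (LINT x|M. x ^ n * exp (s * x))
      - h * (LINT x|M. x ^ Suc n * exp (s * x))\<bar>
    = \<bar>LINT x|M. x ^ n * exp ((s + h) * x) - x ^ n * exp (s * x) - h * (x ^ Suc n * exp (s * x))\<bar>"
    by (simp only: int integrable_mult_right Bochner_Integration.integrable_diff
        Bochner_Integration.integral_diff integral_mult_right_zero)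
  also have "\<dots> \<le> (LINT x|M. \<bar>x ^ n * exp ((s + h) * x) - x ^ n * exp (s * x) - h * (x ^ Suc n * exp (s * x))\<bar>)"
    by (rule integral_abs_bound)
  also have "\<dots> \<le> (LINT x|M. h\<^sup>2 * (\<bar>x\<bar> ^ (n + 2) * exp (\<delta> * \<bar>x\<bar>)))"
  proof (rule integral_mono)
    fix x
    have "\<bar>exp (h * x) - 1 - h * x\<bar> \<le> exp \<bar>h * x\<bar> * \<bar>h * x\<bar>\<^sup>2"
    proof -
      have "(\<Sum>i\<le>1. (h * x) ^ i / fact i) = 1 + h * x" by simp
      then show ?thesis
        using Taylor_exp_field[of "h * x" 1]
        by (simp only: diff_diff_eq real_norm_def Suc_1 fact_1 div_by_1)
    qed
    note Taylor = this
    have "exp ((s + h) * x) = exp (s * x) * exp (h * x)" by (simp add: distrib_right exp_add)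
    then have "x ^ n * exp ((s + h) * x) - x ^ n * exp (s * x) - h * (x ^ Suc n * exp (s * x))
        = x ^ n * exp (s * x) * (exp (h * x) - 1 - h * x)"
      by (simp add: algebra_simps)
    then have "\<bar>x ^ n * exp ((s + h) * x) - x ^ n * exp (s * x) - h * (x ^ Suc n * exp (s * x))\<bar>
        = \<bar>x\<bar> ^ n * exp (s * x) * \<bar>exp (h * x) - 1 - h * x\<bar>"
      by (simp only: abs_mult power_abs abs_exp_cancel)
    also have "\<dots> \<le> \<bar>x\<bar> ^ n * exp (s * x) * (exp \<bar>h * x\<bar> * \<bar>h * x\<bar>\<^sup>2)"
      using Taylor by (rule mult_left_mono) simp
    also have "\<dots> = h\<^sup>2 * \<bar>x\<bar> ^ (n + 2) * exp (s * x + \<bar>h * x\<bar>)"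
    proof -
      have "\<bar>h * x\<bar>\<^sup>2 = h\<^sup>2 * \<bar>x\<bar>\<^sup>2" by (simp add: power_mult_distrib)
      then show ?thesis by (simp only: exp_add power_add mult_ac)
    qed
    also have "\<dots> \<le> h\<^sup>2 * \<bar>x\<bar> ^ (n + 2) * exp (\<delta> * \<bar>x\<bar>)"
    proof (rule mult_left_mono)
      have "s * x \<le> \<bar>s\<bar> * \<bar>x\<bar>" by (metis abs_ge_self abs_mult)
      moreover have "(\<bar>s\<bar> + \<bar>h\<bar>) * \<bar>x\<bar> \<le> \<delta> * \<bar>x\<bar>" using h by (intro mult_right_mono) auto
      ultimately show "exp (s * x + \<bar>h * x\<bar>) \<le> exp (\<delta> * \<bar>x\<bar>)"
        by (simp add: abs_mult distrib_right)
    qed simp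
    finally show "\<bar>x ^ n * exp ((s + h) * x) - x ^ n * exp (s * x) - h * (x ^ Suc n * exp (s * x))\<bar>
      \<le> h\<^sup>2 * (\<bar>x\<bar> ^ (n + 2) * exp (\<delta> * \<bar>x\<bar>))"
      by (simp only: mult.assoc)
  qed (intro integrable_abs Bochner_Integration.integrable_diff integrable_mult_right int integrable_exp_moment)+
  finally show "\<bar>(LINT x|M. x ^ n * exp ((s + h) * x)) - (LINT x|M. x ^ n * exp (s * x))
      - h * (LINT x|M. x ^ Suc n * exp (s * x))\<bar> \<le> (LINT x|M. \<bar>x\<bar> ^ (n + 2) * exp (\<delta> * \<bar>x\<bar>)) * h\<^sup>2"
    by (simp add: mult.commute)
qed

lemma
  shows deriv_mgf: "deriv (\<lambda>s. LINT x|M. exp (s * x)) 0 = (LINT x|M. x)" (is ?A)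
    and deriv2_mgf: "deriv (deriv (\<lambda>s. LINT x|M. exp (s * x))) 0 = (LINT x|M. x\<^sup>2)" (is ?B)
proof -
  have 1: "deriv (\<lambda>s. LINT x|M. exp (s * x)) s = (LINT x|M. x * exp (s * x))" if "\<bar>s\<bar> < \<delta>" for s
    using DERIV_exp_moment[OF that, of 0] by (simp add: DERIV_imp_deriv)
  then show ?A using delta_pos by simp
  have "\<forall>\<^sub>F s in nhds (0::real). \<bar>s\<bar> < \<delta>"
    using delta_pos by (auto simp: eventually_nhds_metric dist_real_def)
  then have "\<forall>\<^sub>F s in nhds 0. deriv (\<lambda>s. LINT x|M. exp (s * x)) s = (LINT x|M. x ^ 1 * exp (s * x))"
    by eventually_elim (simp add: 1)
  then have "deriv (deriv (\<lambda>s. LINT x|M. exp (s * x))) 0 = deriv (\<lambda>s. LINT x|M. x ^ 1 * exp (s * x)) 0"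
    by (rule deriv_cong_ev) simp
  also have "\<dots> = (LINT x|M. x ^ 2 * exp (0 * x))"
    using DERIV_exp_moment[of 0 1] delta_pos by (simp add: DERIV_imp_deriv numeral_2_eq_2)
  finally show ?B by simp
qed

lemma char_quadratic_approx:
  obtains C where "\<And>w. cmod (char M w - (1 + \<i> * w * (LINT x|M. x) - w\<^sup>2 * (LINT x|M. x\<^sup>2) / 2)) \<le> C * \<bar>w\<bar> ^ 3"
proof
  fix w
  have "cmod (char M w - (\<Sum>k\<le>2. ((\<i> * w) ^ k / fact k) * (LINT x|M. x ^ k)))
    \<le> (\<bar>w\<bar> ^ 2 / fact (Suc 2)) * (LINT x|M. min (2 * \<bar>x\<bar> ^ 2 * Suc 2) (\<bar>w\<bar> * \<bar>x\<bar> ^ Suc 2))"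
    using char_approx2[of 2 w] integrable_moment by simp
  also have "\<dots> \<le> (\<bar>w\<bar> ^ 2 / fact (Suc 2)) * (LINT x|M. \<bar>w\<bar> * \<bar>x\<bar> ^ 3)"
  proof (intro mult_left_mono integral_mono)
    have *: "integrable M (\<lambda>x. \<bar>x\<bar> ^ k)" for k
      using integrable_abs[OF integrable_moment[of k]] by (simp add: power_abs)
    show "integrable M (\<lambda>x. \<bar>w\<bar> * \<bar>x\<bar> ^ 3)" using * by auto
    show "integrable M (\<lambda>x. min (2 * \<bar>x\<bar> ^ 2 * Suc 2) (\<bar>w\<bar> * \<bar>x\<bar> ^ Suc 2))"
      using *[of 2] *[of "Suc 2"] by (intro integrable_min integrable_mult_right integrable_mult_left) auto
  qed (auto simp: numeral_3_eq_3 numeral_2_eq_2)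
  also have "\<dots> = (LINT x|M. \<bar>x\<bar> ^ 3) / 6 * \<bar>w\<bar> ^ 3"
    by (simp add: fact_numeral power3_eq_cube power2_eq_square)
  also have "(\<Sum>k\<le>2. ((\<i> * w) ^ k / fact k) * (LINT x|M. x ^ k))
      = 1 + \<i> * w * (LINT x|M. x) - w\<^sup>2 * (LINT x|M. x\<^sup>2) / 2"
    using prob_space by (simp add: numeral_2_eq_2 power_mult_distrib algebra_simps)
  finally show "cmod (char M w - (1 + \<i> * w * (LINT x|M. x) - w\<^sup>2 * (LINT x|M. x\<^sup>2) / 2))
    \<le> (LINT x|M. \<bar>x\<bar> ^ 3) / 6 * \<bar>w\<bar> ^ 3" .
qed

end

section \<open>Weak limits of densities\<close>

text \<open>Division by \<open>m\<close> turns the densities into laws and the hypothesis into convergence of their characteristic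
functions; for \<open>m = 0\<close> all the densities vanish almost everywhere. Levy's continuity theorem concerns sequences of laws; along a sequence of times tending to infinity, the finitely many times below
\<open>1\<close> are replaced by \<open>1\<close> so that every term is a law.\<close>
lemma weak_limit_of_densities:
  fixes f g :: "real \<Rightarrow> real \<Rightarrow> real"
  assumes f: "\<And>t. t > 0 \<Longrightarrow> integrable lborel (f t)"
    and nonneg: "\<And>t. t > 0 \<Longrightarrow> AE x in lborel. f t x \<ge> 0"
    and mass: "\<And>t. t > 0 \<Longrightarrow> (LINT x|lborel. f t x) = m"
    and g[measurable]: "\<And>t. g t \<in> borel_measurable borel"
    and N: "real_distribution N"
    and lim: "\<And>\<xi>. ((\<lambda>t. LINT x|lborel. iexp (\<xi> * g t x) * f t x) \<longlongrightarrow> m * char N \<xi>) at_top"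
    and \<phi>: "continuous_on UNIV \<phi>" "bounded (range \<phi>)"
  shows "((\<lambda>t. LINT x|lborel. \<phi> (g t x) * f t x) \<longlongrightarrow> m * (LINT x|N. \<phi> x)) at_top"
proof (cases "m = 0")
  case True
  have "(LINT x|lborel. \<phi> (g t x) * f t x) = 0" if t: "t > 0" for t
  proof -
    have "AE x in lborel. f t x = 0"
      using integral_nonneg_eq_0_iff_AE[OF f[OF t] nonneg[OF t]] mass[OF t] True by simp
    then show ?thesis by (intro integral_eq_zero_AE) auto
  qed
  then have "\<forall>\<^sub>F t in at_top. (LINT x|lborel. \<phi> (g t x) * f t x) = 0"
    by (intro eventually_at_top_linorderI[of 1]) auto
  then show ?thesis using True by (simp add: tendsto_eventually)
next
  case False
  have "m \<ge> 0" using integral_nonneg_AE[OF nonneg[of 1]] mass[of 1] by simp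
  with False have m: "m > 0" by simp
  have [measurable]: "\<phi> \<in> borel_measurable borel"
    using \<phi>(1) by (rule borel_measurable_continuous_onI)
  obtain B where B: "\<And>x. norm (\<phi> x) \<le> B" using \<phi>(2) by (auto simp: bounded_iff)
  show ?thesis
  proof (rule tendsto_at_topI_sequentially)
    fix X :: "nat \<Rightarrow> real" assume X: "filterlim X at_top sequentially"
    define Y where "Y n = max 1 (X n)" for n
    have Y: "Y n > 0" for n by (simp add: Y_def)
    have XY: "\<forall>\<^sub>F n in sequentially. Y n = X n"
      using filterlim_at_top[THEN iffD1, OF X, rule_format, of 1]
      by eventually_elim (simp add: Y_def)
    have [measurable]: "f (Y n) \<in> borel_measurable borel" for n using f[OF Y] by auto
    define D where "D n = distr (density lborel (\<lambda>x. ennreal (f (Y n) x / m))) borel (g (Y n))" for n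
    have nn: "AE x in lborel. 0 \<le> f (Y n) x / m" for n
      using nonneg[OF Y, of n] by eventually_elim (use m in simp)
    have D: "real_distribution (D n)" for n
    proof -
      have "(\<integral>\<^sup>+ x. ennreal (f (Y n) x / m) \<partial>lborel) = ennreal (LINT x|lborel. f (Y n) x / m)"
        using f[OF Y] nn by (intro nn_integral_eq_integral) auto
      then have "prob_space (density lborel (\<lambda>x. ennreal (f (Y n) x / m)))"
        using mass[OF Y, of n] m by (intro prob_spaceI) (simp add: emeasure_density)
      then show ?thesis unfolding D_def
        by (intro prob_space.real_distribution_distr) auto
    qed
    have int: "(LINT x|D n. h x) = (LINT x|lborel. (f (Y n) x / m) *\<^sub>R h (g (Y n) x))"
      if [measurable]: "h \<in> borel_measurable borel" for n and h :: "real \<Rightarrow> 'b::{banach, second_countable_topology}"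
      unfolding D_def by (subst integral_distr, simp, simp, subst integral_density) (use nn in auto)
    have char: "char (D n) \<xi> = (LINT x|lborel. iexp (\<xi> * g (Y n) x) * f (Y n) x) / m" for n \<xi>
      unfolding char_def
      by (subst int, simp, subst integral_divide_zero[symmetric])
         (auto simp: scaleR_conv_of_real mult_ac intro!: Bochner_Integration.integral_cong)
    have "weak_conv_m D N"
    proof (rule levy_continuity[OF D N])
      fix \<xi>
      have "(\<lambda>n. (LINT x|lborel. iexp (\<xi> * g (X n) x) * f (X n) x) / m) \<longlonglongrightarrow> m * char N \<xi> / m"
        using m by (intro tendsto_intros filterlim_compose[OF lim X]) auto
      moreover have "\<forall>\<^sub>F n in sequentially. (LINT x|lborel. iexp (\<xi> * g (X n) x) * f (X n) x) / m = char (D n) \<xi>"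
        using XY by eventually_elim (simp add: char)
      ultimately show "(\<lambda>n. char (D n) \<xi>) \<longlonglongrightarrow> char N \<xi>"
        using m by (auto dest: Lim_transform_eventually)
    qed
    then have "(\<lambda>n. LINT x|D n. \<phi> x) \<longlonglongrightarrow> (LINT x|N. \<phi> x)"
      using \<phi>(1) B by (intro weak_conv_imp_integral_bdd_continuous_conv[OF D N])
        (auto simp: continuous_on_eq_continuous_at)
    then have "(\<lambda>n. m * (LINT x|D n. \<phi> x)) \<longlonglongrightarrow> m * (LINT x|N. \<phi> x)"
      by (intro tendsto_intros)
    moreover have "\<forall>\<^sub>F n in sequentially. m * (LINT x|D n. \<phi> x) = (LINT x|lborel. \<phi> (g (X n) x) * f (X n) x)"
      using XY
    proof eventually_elim
      fix n assume n: "Y n = X n"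
      have "m * (LINT x|D n. \<phi> x) = m * (LINT x|lborel. \<phi> (g (Y n) x) * f (Y n) x / m)"
        by (simp add: int mult.commute)
      then show "m * (LINT x|D n. \<phi> x) = (LINT x|lborel. \<phi> (g (X n) x) * f (X n) x)"
        using m n by simp
    qed
    ultimately show "(\<lambda>n. LINT x|lborel. \<phi> (g (X n) x) * f (X n) x) \<longlonglongrightarrow> m * (LINT x|N. \<phi> x)"
      by (rule Lim_transform_eventually)
  qed
qed

section \<open>Law of large numbers and central limit theorem for convolution flows\<close>

context convolution_flow
begin

lemma fourier_initial_continuous:
  assumes w: "(w \<longlongrightarrow> 0) at_top"
  shows "((\<lambda>t::real. LINT x|lborel. iexp (w t * x) * f 0 x) \<longlongrightarrow> (LINT x|lborel. f 0 x)) at_top"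
proof -
  have [measurable]: "f 0 \<in> borel_measurable borel" using integrable_flow[of 0] by auto
  have "((\<lambda>t. LINT x|lborel. iexp (w t * x) * f 0 x) \<longlongrightarrow> (LINT x|lborel. iexp (0 * x) * f 0 x)) at_top"
  proof (rule integral_dominated_convergence_at_top)
    show "integrable lborel (\<lambda>x. \<bar>f 0 x\<bar>)" using integrable_flow[of 0] by auto
    show "\<forall>\<^sub>F t in at_top. AE x in lborel. norm (iexp (w t * x) * f 0 x) \<le> \<bar>f 0 x\<bar>"
      by (simp add: norm_mult)
    show "AE x in lborel. ((\<lambda>t. iexp (w t * x) * f 0 x) \<longlongrightarrow> iexp (0 * x) * f 0 x) at_top"
      using w by (intro AE_I2 tendsto_intros)
  qed measurable
  then show ?thesis by simp
qed

text \<open>Since \<open>w t\<close> tends to \<open>0\<close>, the initial density enters the limit only through its mass, and the scaling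
limit is decided by the exponent alone.\<close>
lemma fourier_limit:
  fixes w b :: "real \<Rightarrow> real" and c :: complex
  assumes w: "(w \<longlongrightarrow> 0) at_top"
    and e: "((\<lambda>t. t * (char Q (w t) - 1) + \<i> * b t) \<longlongrightarrow> c) at_top"
  shows "((\<lambda>t. LINT x|lborel. iexp (w t * x + b t) * f t x) \<longlongrightarrow> (LINT x|lborel. f 0 x) * exp c) at_top"
proof -
  have "((\<lambda>t. (LINT x|lborel. iexp (w t * x) * f 0 x) * exp (t * (char Q (w t) - 1) + \<i> * b t))
      \<longlongrightarrow> (LINT x|lborel. f 0 x) * exp c) at_top"
    by (intro tendsto_intros fourier_initial_continuous w e)
  moreover have "(LINT x|lborel. iexp (w t * x) * f 0 x) * exp (t * (char Q (w t) - 1) + \<i> * b t)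
      = (LINT x|lborel. iexp (w t * x + b t) * f t x)" if t: "t \<ge> 0" for t
  proof -
    have "(LINT x|lborel. iexp (w t * x + b t) * f t x) = (LINT x|lborel. exp (\<i> * b t) * (iexp (w t * x) * f t x))"
      by (intro Bochner_Integration.integral_cong) (auto simp: ring_distribs exp_add)
    also have "\<dots> = exp (\<i> * b t) * (LINT x|lborel. iexp (w t * x) * f t x)"
      by (rule integral_mult_right_zero)
    also have "\<dots> = exp (\<i> * b t) * (exp (t * (char Q (w t) - 1)) * (LINT x|lborel. iexp (w t * x) * f 0 x))"
      by (simp only: fourier_flow[OF t])
    finally show ?thesis by (simp only: exp_add mult_ac)
  qed
  then have "\<forall>\<^sub>F t in at_top. (LINT x|lborel. iexp (w t * x) * f 0 x) * exp (t * (char Q (w t) - 1) + \<i> * b t)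
      = (LINT x|lborel. iexp (w t * x + b t) * f t x)"
    by (intro eventually_at_top_linorderI[of 0])
  ultimately show ?thesis by (rule Lim_transform_eventually)
qed

end

locale convolution_flow_exp_moments = convolution_flow Q f + real_distribution_exp_moments Q \<delta>
  for Q :: "real measure" and f and \<delta> :: real
begin

text \<open>With \<open>w = \<xi>/t\<close> the quadratic and cubic terms of the expansion of the characteristic function contribute
\<open>O(1/t)\<close> to \<open>t (char Q w - 1)\<close>; the limit law is the point mass at the mean.\<close>
lemma law_of_large_numbers:
  assumes \<phi>: "continuous_on UNIV \<phi>" "bounded (range \<phi>)"
  shows "((\<lambda>t. LINT x|lborel. \<phi> (x / t) * f t x)
    \<longlongrightarrow> (LINT x|lborel. f 0 x) * \<phi> (LINT x|Q. x)) at_top"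
proof -
  define m where "m = (LINT x|Q. x)"
  define m2 where "m2 = (LINT x|Q. x\<^sup>2)"
  obtain C where C: "\<And>w. cmod (char Q w - (1 + \<i> * w * m - w\<^sup>2 * m2 / 2)) \<le> C * \<bar>w\<bar> ^ 3"
    using char_quadratic_approx unfolding m_def m2_def by metis
  have "((\<lambda>t. LINT x|lborel. \<phi> (x / t) * f t x)
    \<longlongrightarrow> (LINT x|lborel. f 0 x) * (LINT x|return borel m. \<phi> x)) at_top"
  proof (rule weak_limit_of_densities[OF _ _ _ _ _ _ \<phi>])
    show "real_distribution (return borel m)"
      by (auto simp: real_distribution_def real_distribution_axioms_def intro: prob_space_return)
    fix \<xi> :: real
    define w where "w t = \<xi> / t" for t :: real
    have w: "(w \<longlongrightarrow> 0) at_top"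
      unfolding w_def by (intro real_tendsto_divide_at_top[of _ \<xi>] tendsto_const filterlim_ident)
    have "((\<lambda>t. t * (char Q (w t) - 1) - \<i> * (\<xi> * m)) \<longlongrightarrow> 0) at_top"
    proof (rule Lim_null_comparison)
      show "((\<lambda>t. C * \<bar>\<xi>\<bar> ^ 3 * inverse t ^ 2 + \<xi>\<^sup>2 * \<bar>m2\<bar> / 2 * inverse t) \<longlongrightarrow> 0) at_top"
      proof -
        have inv: "(inverse \<longlongrightarrow> (0::real)) at_top"
          by (intro tendsto_inverse_0_at_top filterlim_ident)
        have "((\<lambda>t. C * \<bar>\<xi>\<bar> ^ 3 * inverse t ^ 2 + \<xi>\<^sup>2 * \<bar>m2\<bar> / 2 * inverse t)
            \<longlongrightarrow> C * \<bar>\<xi>\<bar> ^ 3 * 0 ^ 2 + \<xi>\<^sup>2 * \<bar>m2\<bar> / 2 * 0) at_top"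
          by (intro tendsto_intros inv)
        then show ?thesis by simp
      qed
      have "cmod (t * (char Q (w t) - 1) - \<i> * (\<xi> * m)) \<le> C * \<bar>\<xi>\<bar> ^ 3 * inverse t ^ 2 + \<xi>\<^sup>2 * \<bar>m2\<bar> / 2 * inverse t"
        if t: "t > 0" for t
      proof -
        have tw: "t * w t = \<xi>" using t by (simp add: w_def)
        then have twc: "complex_of_real \<xi> = of_real t * of_real (w t)" by (metis of_real_mult)
        have "t * (char Q (w t) - 1) - \<i> * (\<xi> * m)
            = t * (char Q (w t) - (1 + \<i> * w t * m - (w t)\<^sup>2 * m2 / 2)) - of_real (t * (w t)\<^sup>2 * m2 / 2)"
          by (simp add: algebra_simps twc)
        also have "cmod \<dots> \<le> cmod (t * (char Q (w t) - (1 + \<i> * w t * m - (w t)\<^sup>2 * m2 / 2)))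
            + cmod (of_real (t * (w t)\<^sup>2 * m2 / 2))"
          by (rule norm_triangle_ineq4)
        also have "\<dots> \<le> t * (C * \<bar>w t\<bar> ^ 3) + \<bar>t * (w t)\<^sup>2 * m2 / 2\<bar>"
        proof (rule add_mono)
          show "cmod (t * (char Q (w t) - (1 + \<i> * w t * m - (w t)\<^sup>2 * m2 / 2))) \<le> t * (C * \<bar>w t\<bar> ^ 3)"
            unfolding norm_mult norm_of_real abs_of_pos[OF t] using C t by (intro mult_left_mono) auto
        qed (simp only: norm_of_real)
        also have "t * (C * \<bar>w t\<bar> ^ 3) = C * \<bar>\<xi>\<bar> ^ 3 * inverse t ^ 2"
        proof -
          have "\<bar>w t\<bar> = \<bar>\<xi>\<bar> * inverse t" using t by (simp add: w_def abs_mult divide_inverse)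
          then have "t * (C * \<bar>w t\<bar> ^ 3) = C * \<bar>\<xi>\<bar> ^ 3 * inverse t ^ 2 * (t * inverse t)"
            by (simp only: power3_eq_cube power2_eq_square mult_ac)
          also have "t * inverse t = 1" using t by simp
          finally show ?thesis by (simp only: mult_1_right)
        qed
        also have "\<bar>t * (w t)\<^sup>2 * m2 / 2\<bar> = \<xi>\<^sup>2 * \<bar>m2\<bar> / 2 * inverse t"
        proof -
          have "t * (w t)\<^sup>2 = \<xi> * (\<xi> * inverse t)"
            using t by (simp add: w_def power2_eq_square divide_inverse)
          also have "\<dots> = \<xi>\<^sup>2 * inverse t" by (simp only: power2_eq_square mult_ac)
          finally have "t * (w t)\<^sup>2 = \<xi>\<^sup>2 * inverse t" .
          then show ?thesis using t by (simp add: abs_mult)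
        qed
        finally show ?thesis .
      qed
      then show "\<forall>\<^sub>F t in at_top. cmod (t * (char Q (w t) - 1) - \<i> * (\<xi> * m))
          \<le> C * \<bar>\<xi>\<bar> ^ 3 * inverse t ^ 2 + \<xi>\<^sup>2 * \<bar>m2\<bar> / 2 * inverse t"
        by (intro eventually_at_top_linorderI[of 1]) auto
    qed
    then have "((\<lambda>t. t * (char Q (w t) - 1) + \<i> * of_real ((\<lambda>_. 0) t)) \<longlongrightarrow> \<i> * (\<xi> * m)) at_top"
      by (simp add: LIM_zero_iff)
    from fourier_limit[OF w this]
    show "((\<lambda>t. LINT x|lborel. iexp (\<xi> * (x / t)) * f t x)
        \<longlongrightarrow> (LINT x|lborel. f 0 x) * char (return borel m) \<xi>) at_top"
      by (simp add: w_def char_def integral_return)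
    fix t :: real assume "t > 0"
    then have t: "t \<ge> 0" by simp
    show "integrable lborel (f t)" by (rule integrable_flow[OF t])
    show "AE x in lborel. f t x \<ge> 0" by (rule nonneg_flow[OF t])
    show "(LINT x|lborel. f t x) = (LINT x|lborel. f 0 x)" by (rule integral_flow[OF t])
  qed simp
  moreover have "(LINT x|return borel m. \<phi> x) = \<phi> m"
    using \<phi>(1) by (intro integral_return) (auto intro: borel_measurable_continuous_onI)
  ultimately show ?thesis by (simp add: m_def)
qed

text \<open>With \<open>w = \<xi>/(\<sigma>\<surd>t)\<close> the centring removes the linear term, the quadratic term is exactly
\<open>-\<xi>\<^sup>2/2\<close>, and the cubic error contributes \<open>O(1/\<surd>t)\<close>. The variance of a compound Poisson process is governed by the second moment
of its jumps, not by their variance, so \<open>\<sigma>\<^sup>2\<close> is the raw second moment of \<open>Q\<close>.\<close>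
lemma central_limit:
  assumes \<phi>: "continuous_on UNIV \<phi>" "bounded (range \<phi>)"
    and \<sigma>: "\<sigma> > 0" "\<sigma>\<^sup>2 = (LINT x|Q. x\<^sup>2)"
  defines "m \<equiv> LINT x|Q. x"
  shows "((\<lambda>t. LINT x|lborel. \<phi> ((x - t * m) / (\<sigma> * sqrt t)) * f t x)
    \<longlongrightarrow> (LINT x|lborel. f 0 x) * (LINT x|std_normal_distribution. \<phi> x)) at_top"
proof (rule weak_limit_of_densities[OF _ _ _ _ real_dist_normal_dist _ \<phi>])
  define m2 where "m2 = (LINT x|Q. x\<^sup>2)"
  obtain C where C: "\<And>w. cmod (char Q w - (1 + \<i> * w * m - w\<^sup>2 * m2 / 2)) \<le> C * \<bar>w\<bar> ^ 3"
    using char_quadratic_approx unfolding m_def m2_def by metis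
  fix \<xi> :: real
  define w where "w t = \<xi> / (\<sigma> * sqrt t)" for t :: real
  define b where "b t = - (w t * t * m)" for t
  have inv: "((\<lambda>t. inverse (sqrt t)) \<longlongrightarrow> 0) at_top"
    by (intro tendsto_inverse_0_at_top sqrt_at_top)
  have w: "(w \<longlongrightarrow> 0) at_top"
  proof -
    have "w = (\<lambda>t. \<xi> / \<sigma> * inverse (sqrt t))" by (simp add: w_def fun_eq_iff divide_inverse)
    then show ?thesis using tendsto_mult_right_zero[OF inv, of "\<xi> / \<sigma>"] by simp
  qed
  have "((\<lambda>t. t * (char Q (w t) - 1) + \<i> * b t - complex_of_real (- (\<xi>\<^sup>2) / 2)) \<longlongrightarrow> 0) at_top"
  proof (rule Lim_null_comparison)
    show "((\<lambda>t. C * \<bar>\<xi>\<bar> ^ 3 / \<sigma> ^ 3 * inverse (sqrt t)) \<longlongrightarrow> 0) at_top"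
      by (intro tendsto_mult_right_zero inv)
    have "cmod (t * (char Q (w t) - 1) + \<i> * b t - complex_of_real (- (\<xi>\<^sup>2) / 2)) \<le> C * \<bar>\<xi>\<bar> ^ 3 / \<sigma> ^ 3 * inverse (sqrt t)"
      if t: "t > 0" for t
    proof -
      have "t * (w t)\<^sup>2 * m2 = \<xi>\<^sup>2"
        using t \<sigma>(1) by (simp add: w_def power_divide power_mult_distrib m2_def flip: \<sigma>(2))
      then have twc: "(complex_of_real \<xi>)\<^sup>2 = of_real t * (of_real (w t))\<^sup>2 * of_real m2"
        by (metis of_real_mult of_real_power)
      have "t * (char Q (w t) - 1) + \<i> * b t - complex_of_real (- (\<xi>\<^sup>2) / 2)
          = t * (char Q (w t) - (1 + \<i> * w t * m - (w t)\<^sup>2 * m2 / 2))"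
        by (simp add: b_def algebra_simps twc)
      also have "cmod \<dots> \<le> t * (C * \<bar>w t\<bar> ^ 3)"
        unfolding norm_mult norm_of_real abs_of_pos[OF t] using C t by (intro mult_left_mono) auto
      also have "\<dots> = C * \<bar>\<xi>\<bar> ^ 3 / \<sigma> ^ 3 * (t / sqrt t ^ 3)"
        using t \<sigma>(1) by (simp add: w_def power_divide power_mult_distrib abs_mult)
      also have "t / sqrt t ^ 3 = inverse (sqrt t)"
      proof -
        have "sqrt t ^ 3 = t * sqrt t" using t by (simp add: power3_eq_cube)
        then show ?thesis using t by (simp add: divide_inverse)
      qed
      finally show ?thesis .
    qed
    then show "\<forall>\<^sub>F t in at_top. cmod (t * (char Q (w t) - 1) + \<i> * b t - complex_of_real (- (\<xi>\<^sup>2) / 2))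
        \<le> C * \<bar>\<xi>\<bar> ^ 3 / \<sigma> ^ 3 * inverse (sqrt t)"
      by (intro eventually_at_top_linorderI[of 1]) auto
  qed
  then have e: "((\<lambda>t. t * (char Q (w t) - 1) + \<i> * b t) \<longlongrightarrow> complex_of_real (- (\<xi>\<^sup>2) / 2)) at_top"
    by (rule LIM_zero_cancel)
  have "\<xi> * ((x - t * m) / (\<sigma> * sqrt t)) = w t * x + b t" for t x
    by (simp add: w_def b_def right_diff_distrib diff_divide_distrib)
  then show "((\<lambda>t. LINT x|lborel. iexp (\<xi> * ((x - t * m) / (\<sigma> * sqrt t))) * f t x)
      \<longlongrightarrow> (LINT x|lborel. f 0 x) * char std_normal_distribution \<xi>) at_top"
    using fourier_limit[OF w e] by (simp only: char_std_normal_distribution exp_of_real)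
  fix t :: real assume "t > 0"
  then have t: "t \<ge> 0" by simp
  show "integrable lborel (f t)" by (rule integrable_flow[OF t])
  show "AE x in lborel. f t x \<ge> 0" by (rule nonneg_flow[OF t])
  show "(LINT x|lborel. f t x) = (LINT x|lborel. f 0 x)" by (rule integral_flow[OF t])
qed simp

end

section \<open>The law of the logarithmic fragment size\<close>

definition log_size_law :: "real measure \<Rightarrow> real measure" where
  "log_size_law k = distr (density k (\<lambda>z. ennreal (indicator {0<..1} z * z))) borel ln"

lemma
  assumes k: "fragmentation_kernel k"
  shows integral_log_size_law:
      "h \<in> borel_measurable borel \<Longrightarrow>
        (LINT x|log_size_law k. h x) = (LINT z:{0<..1}|k. z * h (ln z) :: real)"
    and integrable_log_size_law:
      "h \<in> borel_measurable borel \<Longrightarrow>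
        integrable (log_size_law k) h \<longleftrightarrow> set_integrable k {0<..1} (\<lambda>z. z * h (ln z) :: real)"
    and real_distribution_log_size_law: "real_distribution (log_size_law k)"
proof -
  have [measurable_cong, simp]: "sets k = sets borel" using k by (simp add: fragmentation_kernel_def)
  have [measurable]: "(\<lambda>z. ennreal (indicator {0<..1} z * z)) \<in> borel_measurable k"
    "(\<lambda>z. indicator {0<..1} z * z :: real) \<in> borel_measurable k" by measurable
  have pos: "AE z in k. 0 \<le> indicator {0<..1} z * (z::real)" by (auto split: split_indicator)
  have ln': "ln \<in> measurable (density k (\<lambda>z. ennreal (indicator {0<..1} z * z))) borel" by measurable
  show I: "(LINT x|log_size_law k. h x) = (LINT z:{0<..1}|k. z * h (ln z))"
    if [measurable]: "h \<in> borel_measurable borel" for h :: "real \<Rightarrow> real"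
  proof -
    have "(LINT x|log_size_law k. h x) = (LINT z|k. (indicator {0<..1} z * z) *\<^sub>R h (ln z))"
      unfolding log_size_law_def using pos
      by (subst integral_distr[OF ln'], simp, subst integral_density) auto
    then show ?thesis by (simp add: set_lebesgue_integral_def mult_ac)
  qed
  show "integrable (log_size_law k) h \<longleftrightarrow> set_integrable k {0<..1} (\<lambda>z. z * h (ln z))"
    if [measurable]: "h \<in> borel_measurable borel" for h :: "real \<Rightarrow> real"
  proof -
    have "integrable (log_size_law k) h \<longleftrightarrow> integrable k (\<lambda>z. (indicator {0<..1} z * z) *\<^sub>R h (ln z))"
      unfolding log_size_law_def using pos
      by (subst integrable_distr_eq[OF ln'], simp, subst integrable_density) auto
    then show ?thesis by (simp add: set_integrable_def mult_ac)
  qed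
  interpret k: finite_measure k using k by (simp add: fragmentation_kernel_def)
  have "integrable k (\<lambda>z. indicator {0<..1} z * z :: real)"
    by (rule k.integrable_const_bound[of _ 1]) (auto split: split_indicator)
  then have "(\<integral>\<^sup>+ z. ennreal (indicator {0<..1} z * z) \<partial>k) = ennreal (LINT z|k. indicator {0<..1} z * z)"
    using pos by (rule nn_integral_eq_integral)
  also have "(LINT z|k. indicator {0<..1} z * z) = 1"
    using k by (simp add: fragmentation_kernel_def set_lebesgue_integral_def)
  finally have "prob_space (density k (\<lambda>z. ennreal (indicator {0<..1} z * z)))"
    using sets_eq_imp_space_eq[of k borel] by (intro prob_spaceI) (simp add: emeasure_density)
  then show "real_distribution (log_size_law k)"
    unfolding log_size_law_def by (intro prob_space.real_distribution_distr) auto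
qed

text \<open>Against \<open>z k(dz)\<close> the weight \<open>exp (\<bar>ln z\<bar>/2) = 1/\<surd>z\<close> leaves \<open>\<surd>z \<bar>ln z\<bar>\<^sup>n\<close>, which is bounded on \<open>(0, 1]\<close>,
and \<open>k\<close> is finite.\<close>
lemma exp_moments_log_size_law:
  assumes k: "fragmentation_kernel k"
  shows "real_distribution_exp_moments (log_size_law k) (1/2)"
proof -
  interpret k: finite_measure k using k by (simp add: fragmentation_kernel_def)
  have [measurable_cong, simp]: "sets k = sets borel" using k by (simp add: fragmentation_kernel_def)
  interpret real_distribution "log_size_law k" by (rule real_distribution_log_size_law[OF k])
  show ?thesis
  proof unfold_locales
    fix n :: nat
    have bound: "z * (\<bar>ln z\<bar> ^ n * exp (1/2 * \<bar>ln z\<bar>)) \<le> fact n * 2 ^ n" if z: "z \<in> {0<..1}" for z :: real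
    proof -
      define y where "y = - ln z / 2"
      have y: "y \<ge> 0" "z = exp (- 2 * y)" "\<bar>ln z\<bar> = 2 * y" using z by (auto simp: y_def)
      have "z * (\<bar>ln z\<bar> ^ n * exp (1/2 * \<bar>ln z\<bar>)) = 2 ^ n * (y ^ n * exp (- y))"
        unfolding y(3) by (subst y(2)) (simp add: power_mult_distrib flip: exp_add)
      also have "\<dots> \<le> 2 ^ n * (fact n * exp y * exp (- y))"
        using power_le_fact_mult_exp[OF y(1), of n] by (intro mult_left_mono mult_right_mono) auto
      also have "\<dots> = fact n * 2 ^ n" by (simp add: exp_minus)
      finally show ?thesis .
    qed
    have "integrable k (\<lambda>z. indicator {0<..1} z * (z * (\<bar>ln z\<bar> ^ n * exp (1/2 * \<bar>ln z\<bar>))))"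
    proof (rule k.integrable_const_bound[of _ "fact n * 2 ^ n"])
      show "AE z in k. norm (indicator {0<..1} z * (z * (\<bar>ln z\<bar> ^ n * exp (1/2 * \<bar>ln z\<bar>)))) \<le> fact n * 2 ^ n"
      proof (intro AE_I2)
        fix z :: real
        show "norm (indicator {0<..1} z * (z * (\<bar>ln z\<bar> ^ n * exp (1/2 * \<bar>ln z\<bar>)))) \<le> fact n * 2 ^ n"
        proof (cases "z \<in> {0<..1}")
          case True
          then have "0 \<le> z * (\<bar>ln z\<bar> ^ n * exp (1/2 * \<bar>ln z\<bar>))"
            by (intro mult_nonneg_nonneg) auto
          then have "norm (indicator {0<..1} z * (z * (\<bar>ln z\<bar> ^ n * exp (1/2 * \<bar>ln z\<bar>))))
              = z * (\<bar>ln z\<bar> ^ n * exp (1/2 * \<bar>ln z\<bar>))"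
            unfolding indicator_simps(1)[OF True] mult_1 real_norm_def by (rule abs_of_nonneg)
          also note bound[OF True]
          finally show ?thesis .
        qed simp
      qed
    qed measurable
    then show "integrable (log_size_law k) (\<lambda>x. \<bar>x\<bar> ^ n * exp (1/2 * \<bar>x\<bar>))"
      by (subst integrable_log_size_law[OF k]) (auto simp: set_integrable_def)
  qed simp
qed

lemma kernel_mellin_eq_mgf:
  assumes k: "fragmentation_kernel k"
  shows "kernel_mellin k = (\<lambda>s. LINT x|log_size_law k. exp ((s - 2) * x))"
proof
  fix s
  have "(LINT x|log_size_law k. exp ((s - 2) * x)) = (LINT z:{0<..1}|k. z * exp ((s - 2) * ln z))"
    by (rule integral_log_size_law[OF k]) simp
  also have "\<dots> = (LINT z:{0<..1}|k. z powr (s - 1))"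
    unfolding set_lebesgue_integral_def
  proof (rule Bochner_Integration.integral_cong[OF refl])
    fix z :: real
    have "z * exp ((s - 2) * ln z) = z powr (s - 1)" if "z > 0"
    proof -
      have "z * exp ((s - 2) * ln z) = exp (ln z + (s - 2) * ln z)"
        using that by (simp add: exp_add)
      also have "ln z + (s - 2) * ln z = (s - 1) * ln z" by (simp add: algebra_simps)
      finally show ?thesis using that by (simp add: powr_def)
    qed
    then show "indicat_real {0<..1} z *\<^sub>R (z * exp ((s - 2) * ln z)) = indicat_real {0<..1} z *\<^sub>R z powr (s - 1)"
      by (auto split: split_indicator)
  qed
  finally show "kernel_mellin k s = (LINT x|log_size_law k. exp ((s - 2) * x))"
    by (simp add: kernel_mellin_def)
qed

lemma deriv_translate:
  fixes f :: "real \<Rightarrow> real"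
  shows "deriv (\<lambda>s. f (s - a)) = (\<lambda>s. deriv f (s - a))"
proof
  fix s
  have "((\<lambda>s. f (s - a)) has_real_derivative D) (at s) \<longleftrightarrow> (f has_real_derivative D) (at (s - a))" for D
    using DERIV_at_within_shift[of f D "-a" s UNIV] by simp
  then show "deriv (\<lambda>s. f (s - a)) s = deriv f (s - a)" by (simp add: deriv_def)
qed

lemma
  assumes k: "fragmentation_kernel k"
  shows deriv_kernel_mellin: "deriv (kernel_mellin k) 2 = (LINT x|log_size_law k. x)"
    and deriv2_kernel_mellin: "deriv (deriv (kernel_mellin k)) 2 = (LINT x|log_size_law k. x\<^sup>2)"
proof -
  interpret real_distribution_exp_moments "log_size_law k" "1/2" by (rule exp_moments_log_size_law[OF k])
  note eq = deriv_translate[of "\<lambda>s. LINT x|log_size_law k. exp (s * x)" 2]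
    deriv_translate[of "deriv (\<lambda>s. LINT x|log_size_law k. exp (s * x))" 2]
  show "deriv (kernel_mellin k) 2 = (LINT x|log_size_law k. x)"
    by (simp add: kernel_mellin_eq_mgf[OF k] eq deriv_mgf)
  show "deriv (deriv (kernel_mellin k)) 2 = (LINT x|log_size_law k. x\<^sup>2)"
    by (simp add: kernel_mellin_eq_mgf[OF k] eq deriv2_mgf)
qed

section \<open>Logarithmic change of variables\<close>

text \<open>As an identity of measures, the substitution \<open>y = exp x\<close> transfers integrals, integrability and null sets
alike. It follows from the substitution rule on the compact intervals \<open>[-n, n]\<close> by exhaustion.\<close>
lemma distr_exp_lborel:
  "distr (density lborel (\<lambda>x. ennreal (exp x))) borel exp = density lborel (indicator {0<..})"
  (is "?M = ?N")
proof (rule measure_eqI)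
  show "sets ?M = sets ?N" by simp
  fix A :: "real set" assume "A \<in> sets ?M"
  then have A[measurable]: "A \<in> sets borel" by simp
  define I where "I n = {exp (- real n)..exp (real n)}" for n
  have [measurable]: "I n \<in> sets borel" for n by (simp add: I_def)
  have I_pos: "x > 0" if "x \<in> I n" for x n
    using that less_le_trans[OF exp_gt_zero, of "- real n" x] by (simp add: I_def)
  have inc: "incseq (\<lambda>n. A \<inter> I n)"
  proof (rule monoI)
    fix m n :: nat assume "m \<le> n"
    then have "exp (- real n) \<le> exp (- real m)" "exp (real m) \<le> exp (real n)" by auto
    then have "I m \<subseteq> I n"
      unfolding I_def by (simp only: atLeastatMost_subset_iff simp_thms)
    then show "A \<inter> I m \<subseteq> A \<inter> I n" by blast
  qed
  have un: "(\<Union>n. A \<inter> I n) = A \<inter> {0<..}"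
  proof (intro equalityI subsetI)
    fix x assume x: "x \<in> A \<inter> {0<..}"
    obtain n where "\<bar>ln x\<bar> \<le> real n" using real_arch_simple by blast
    then have "exp (- real n) \<le> exp (ln x)" "exp (ln x) \<le> exp (real n)"
      by auto
    then have "x \<in> I n" using x by (simp add: I_def del: exp_le_cancel_iff)
    then show "x \<in> (\<Union>n. A \<inter> I n)" using x by auto
  qed (use I_pos in auto)
  have piece: "emeasure ?M (A \<inter> I n) = emeasure ?N (A \<inter> I n)" for n
  proof -
    have "emeasure ?N (A \<inter> I n) = (\<integral>\<^sup>+ x. ennreal (indicator A x * indicator {exp (- real n)..exp (real n)} x) \<partial>lborel)"
      by (subst emeasure_density)
        (auto intro!: nn_integral_cong simp: I_def[symmetric] I_pos split: split_indicator)
    also have "\<dots> = (\<integral>\<^sup>+ x. ennreal (indicator A (exp x) * exp x * indicator {- real n..real n} x) \<partial>lborel)"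
      by (rule nn_integral_substitution)
        (auto intro!: derivative_eq_intros continuous_intros simp: set_borel_measurable_def)
    also have "\<dots> = emeasure ?M (A \<inter> I n)"
      by (subst emeasure_distr, simp, simp, subst emeasure_density)
        (auto intro!: nn_integral_cong simp: I_def split: split_indicator)
    finally show ?thesis by simp
  qed
  have "emeasure ?M A = emeasure ?M (A \<inter> {0<..})"
    by (auto simp: emeasure_distr intro!: arg_cong2[where f = emeasure])
  also have "\<dots> = (SUP n. emeasure ?M (A \<inter> I n))"
    using inc by (subst un[symmetric], intro SUP_emeasure_incseq[symmetric]) auto
  also have "\<dots> = (SUP n. emeasure ?N (A \<inter> I n))"
    by (simp add: piece)
  also have "\<dots> = emeasure ?N (A \<inter> {0<..})"
    using inc by (subst un[symmetric], intro SUP_emeasure_incseq) auto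
  also have "\<dots> = emeasure ?N A"
    by (subst (1 2) emeasure_density) (auto intro!: nn_integral_cong split: split_indicator)
  finally show "emeasure ?M A = emeasure ?N A" .
qed

lemma
  fixes g :: "real \<Rightarrow> real"
  assumes g: "set_borel_measurable borel {0<..} g"
  shows integrable_exp_substitution:
      "integrable lborel (\<lambda>x. exp x * g (exp x)) \<longleftrightarrow> set_integrable lborel {0<..} g" (is ?A)
    and integral_exp_substitution:
      "(LINT x|lborel. exp x * g (exp x)) = (LBINT x:{0<..}. g x)" (is ?B)
proof -
  define G where "G x = indicator {0<..} x * g x" for x
  have [measurable]: "G \<in> borel_measurable borel"
    using g by (simp add: G_def[abs_def] set_borel_measurable_def)
  have eq: "exp x * g (exp x) = exp x * G (exp x)" for x by (simp add: G_def)
  have idem: "indicator {0<..} x * G x = G x" for x by (simp add: G_def split: split_indicator)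
  have N: "density lborel (indicator {0<..}) = density lborel (\<lambda>x::real. ennreal (indicator {0<..} x))"
    by (simp add: ennreal_indicator)
  have "integrable lborel (\<lambda>x. exp x * g (exp x)) \<longleftrightarrow> integrable (distr (density lborel (\<lambda>x. ennreal (exp x))) borel exp) G"
    unfolding eq by (subst integrable_distr_eq, simp, simp, subst integrable_density) auto
  also have "\<dots> \<longleftrightarrow> integrable lborel G"
    unfolding distr_exp_lborel N by (subst integrable_density) (auto simp: idem)
  finally show ?A by (simp add: set_integrable_def G_def[abs_def])
  have "(LINT x|lborel. exp x * g (exp x)) = integral\<^sup>L (distr (density lborel (\<lambda>x. ennreal (exp x))) borel exp) G"
    unfolding eq by (subst integral_distr, simp, simp, subst integral_density) auto
  also have "\<dots> = (LINT x|lborel. G x)"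
    unfolding distr_exp_lborel N by (subst integral_density) (auto simp: idem)
  finally show ?B by (simp add: set_lebesgue_integral_def G_def[abs_def])
qed

lemma AE_exp_substitution:
  fixes P :: "real \<Rightarrow> bool"
  assumes "AE x in lborel. x > 0 \<longrightarrow> P x"
  shows "AE x in lborel. P (exp x)"
proof -
  have "AE x in density lborel (indicator {0::real<..}). P x"
    using assms by (subst AE_density) (auto split: split_indicator)
  then have "AE x in distr (density lborel (\<lambda>x. ennreal (exp x))) borel exp. P x"
    by (simp only: distr_exp_lborel)
  then have "AE x in density lborel (\<lambda>x. ennreal (exp x)). P (exp x)"
    by (rule AE_distrD[rotated]) simp
  then show ?thesis by (subst (asm) AE_density) auto
qed

section \<open>The fragmentation equation in logarithmic size\<close>

text \<open>The density in \<open>x\<close> of the mass distribution \<open>y w(y) dy\<close> under \<open>y = exp x\<close>: one factor \<open>exp x\<close> is the mass, the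
other the Jacobian.\<close>
definition log_profile :: "(real \<Rightarrow> real) \<Rightarrow> real \<Rightarrow> real" where
  "log_profile w x = exp (2 * x) * w (exp x)"

lemma log_profile_alt: "log_profile w x = exp x * (exp x * w (exp x))"
  by (simp add: log_profile_def mult.assoc flip: exp_add)

lemma set_borel_measurable_mult_ident:
  assumes w: "in_L1w w"
  shows "set_borel_measurable borel {0<..} (\<lambda>x. x * w x)"
proof -
  have m: "(\<lambda>x. indicator {0<..} x * (w x * (1 + x))) \<in> borel_measurable borel"
    using w by (auto simp: in_L1w_def set_integrable_def)
  have "(\<lambda>x. indicator {0<..} x * (w x * (1 + x)) * (x / (1 + x))) \<in> borel_measurable borel"
    using m by measurable
  also have "(\<lambda>x. indicator {0<..} x * (w x * (1 + x)) * (x / (1 + x))) = (\<lambda>x. indicator {0<..} x *\<^sub>R (x * w x))"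
    by (auto simp: fun_eq_iff field_simps split: split_indicator)
  finally show ?thesis by (simp add: set_borel_measurable_def)
qed

lemma
  assumes w: "in_L1w w"
  shows integrable_log_profile: "integrable lborel (log_profile w)"
    and integral_abs_log_profile_le: "(LINT x|lborel. \<bar>log_profile w x\<bar>) \<le> norm_L1w w"
proof -
  have I: "set_integrable lborel {0<..} (\<lambda>x. w x * (1 + x))" using w by (simp add: in_L1w_def)
  note meas = set_borel_measurable_mult_ident[OF w]
  have II: "set_integrable lborel {0<..} (\<lambda>x. x * w x)"
  proof (rule set_integrable_bound[OF I])
    show "set_borel_measurable lborel {0<..} (\<lambda>x. x * w x)"
      using meas by (simp add: set_borel_measurable_def)
    have "norm (x * w x) \<le> norm (w x * (1 + x))" if "x > 0" for x :: real
      using that by (simp add: abs_mult algebra_simps)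
    then show "AE x in lborel. x \<in> {0<..} \<longrightarrow> norm (x * w x) \<le> norm (w x * (1 + x))" by simp
  qed
  show i: "integrable lborel (log_profile w)"
    using II integrable_exp_substitution[OF meas] by (simp add: log_profile_alt[abs_def])
  have meas': "set_borel_measurable borel {0<..} (\<lambda>x. \<bar>x * w x\<bar>)"
    using meas unfolding set_borel_measurable_def
    by (auto dest: borel_measurable_abs simp: abs_mult)
  have "(LINT x|lborel. \<bar>log_profile w x\<bar>) = (LBINT x:{0<..}. \<bar>x * w x\<bar>)"
    using integral_exp_substitution[OF meas'] by (simp add: log_profile_alt abs_mult)
  also have "\<dots> \<le> (LBINT x:{0<..}. \<bar>w x\<bar> * (1 + x))"
  proof (rule set_integral_mono)
    show "set_integrable lborel {0<..} (\<lambda>x. \<bar>x * w x\<bar>)"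
      using II by (rule set_integrable_abs)
    have "set_integrable lborel {0<..} (\<lambda>x. \<bar>w x\<bar> * (1 + x)) \<longleftrightarrow> set_integrable lborel {0<..} (\<lambda>x. \<bar>w x * (1 + x)\<bar>)"
      by (rule set_integrable_cong) (auto simp: abs_mult)
    then show "set_integrable lborel {0<..} (\<lambda>x. \<bar>w x\<bar> * (1 + x))"
      using set_integrable_abs[OF I] by simp
  qed (auto simp: abs_mult algebra_simps)
  finally show "(LINT x|lborel. \<bar>log_profile w x\<bar>) \<le> norm_L1w w"
    by (simp add: norm_L1w_def)
qed

lemma mellin_2_eq_integral_log_profile:
  assumes "in_L1w w"
  shows "mellin w 2 = (LINT x|lborel. log_profile w x)"
    and "mellin w 2 = (LBINT x:{0<..}. x * w x)"
proof -
  show *: "mellin w 2 = (LBINT x:{0<..}. x * w x)"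
    unfolding mellin_def by (rule set_lebesgue_integral_cong) auto
  show "mellin w 2 = (LINT x|lborel. log_profile w x)"
    using integral_exp_substitution[OF set_borel_measurable_mult_ident[OF assms]]
    by (simp add: log_profile_alt *)
qed

text \<open>Under \<open>y = exp x\<close> the scaling \<open>y \<mapsto> y/z\<close> becomes the translation by \<open>- ln z\<close>, and
\<open>exp (2x) w(exp x / z) / z = z exp (2(x - ln z)) w(exp (x - ln z))\<close>. So the gain term is a convolution with the law of \<open>ln z\<close> under \<open>z k(dz)\<close>.\<close>
lemma convolution_log_profile:
  assumes k: "fragmentation_kernel k" and w: "in_L1w w"
  shows "convolution (log_size_law k) (log_profile w) x
    = exp (2 * x) * (LINT z:{0<..1}|k. w (exp x / z) / z)"
proof -
  have [measurable]: "log_profile w \<in> borel_measurable borel"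
    using integrable_log_profile[OF w] by auto
  have "convolution (log_size_law k) (log_profile w) x
      = (LINT z:{0<..1}|k. z * log_profile w (x - ln z))"
    unfolding convolution_def by (rule integral_log_size_law[OF k]) measurable
  also have "\<dots> = (LINT z:{0<..1}|k. exp (2 * x) * (w (exp x / z) / z))"
    unfolding set_lebesgue_integral_def
  proof (rule Bochner_Integration.integral_cong[OF refl])
    fix z :: real
    have "z * log_profile w (x - ln z) = exp (2 * x) * (w (exp x / z) / z)" if "z > 0"
      using that by (simp add: log_profile_alt exp_diff exp_double power2_eq_square)
    then show "indicat_real {0<..1} z *\<^sub>R (z * log_profile w (x - ln z))
      = indicat_real {0<..1} z *\<^sub>R (exp (2 * x) * (w (exp x / z) / z))"
      by (auto split: split_indicator)
  qed
  finally show ?thesis unfolding set_integral_mult_right .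
qed

lemma in_L1w_diff: "in_L1w f \<Longrightarrow> in_L1w g \<Longrightarrow> in_L1w (\<lambda>x. f x - g x)"
  unfolding in_L1w_def by (drule (1) set_integral_diff(1)) (simp add: left_diff_distrib)

lemma in_L1w_divide: "in_L1w f \<Longrightarrow> in_L1w (\<lambda>x. f x / c)"
  unfolding in_L1w_def using set_integrable_divide[of c lborel "{0<..}" "\<lambda>x. f x * (1 + x)"] by (cases "c = 0") auto

text \<open>The passage to the logarithmic profile is linear and bounded from \<open>L\<^sup>1((1+x)dx)\<close> to \<open>L\<^sup>1(\<real>)\<close>, so continuity and
differentiability in time carry over.\<close>
lemma convolution_flow_log_profile:
  assumes k: "fragmentation_kernel k"
    and u0: "\<And>x. x > 0 \<Longrightarrow> u0 x \<ge> 0"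
    and u: "fragmentation_solution k u0 u"
  shows "convolution_flow_exp_moments (log_size_law k) (\<lambda>t. log_profile (u t)) (1/2)"
proof -
  interpret real_distribution_exp_moments "log_size_law k" "1/2" by (rule exp_moments_log_size_law[OF k])
  obtain v where cu: "continuous_L1w {0..} u" and init: "AE x in lborel. x > 0 \<longrightarrow> u 0 x = u0 x"
    and cv: "continuous_L1w {0<..} v" and der: "has_deriv_L1w {0<..} u v"
    and eq: "\<And>t. t > 0 \<Longrightarrow> AE x in lborel. x > 0 \<longrightarrow> v t x + u t x = (LINT z:{0<..1}|k. u t (x / z) / z)"
    using u unfolding fragmentation_solution_def by auto
  have L: "in_L1w (u t)" if "t \<ge> 0" for t using cu that by (auto simp: continuous_L1w_def)
  have Lv: "in_L1w (v t)" if "t > 0" for t using cv that by (auto simp: continuous_L1w_def)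
  show ?thesis
  proof unfold_locales
    fix t :: real assume t: "0 \<le> t"
    then show "integrable lborel (log_profile (u t))" by (intro integrable_log_profile L)
    show "((\<lambda>s. LINT x|lborel. \<bar>log_profile (u s) x - log_profile (u t) x\<bar>) \<longlongrightarrow> 0) (at t within {0..})"
    proof (rule Lim_null_comparison)
      show "((\<lambda>s. norm_L1w (\<lambda>x. u s x - u t x)) \<longlongrightarrow> 0) (at t within {0..})"
        using cu t by (auto simp: continuous_L1w_def)
      have "(LINT x|lborel. \<bar>log_profile (u s) x - log_profile (u t) x\<bar>) \<le> norm_L1w (\<lambda>x. u s x - u t x)"
        if "s \<ge> 0" for s
        using integral_abs_log_profile_le[OF in_L1w_diff[OF L[OF that] L[OF t]]]
        by (simp add: log_profile_def right_diff_distrib)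
      then show "\<forall>\<^sub>F s in at t within {0..}.
          norm (LINT x|lborel. \<bar>log_profile (u s) x - log_profile (u t) x\<bar>) \<le> norm_L1w (\<lambda>x. u s x - u t x)"
        by (auto simp: eventually_at_filter abs_of_nonneg integral_nonneg_AE)
    qed
  next
    fix t :: real assume t: "0 < t"
    have eq': "AE x in lborel. log_profile (v t) x
        = convolution (log_size_law k) (log_profile (u t)) x - log_profile (u t) x"
      using AE_exp_substitution[OF eq[OF t]]
    proof eventually_elim
      case (elim x)
      have "log_profile (v t) x + log_profile (u t) x = exp (2 * x) * (v t (exp x) + u t (exp x))"
        by (simp add: log_profile_def distrib_left)
      also have "\<dots> = convolution (log_size_law k) (log_profile (u t)) x"
        using t unfolding elim by (simp add: convolution_log_profile[OF k L])
      finally show ?case by simp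
    qed
    show "((\<lambda>s. LINT x|lborel. \<bar>(log_profile (u s) x - log_profile (u t) x) / (s - t)
        - (convolution (log_size_law k) (log_profile (u t)) x - log_profile (u t) x)\<bar>) \<longlongrightarrow> 0) (at t)"
    proof (rule Lim_null_comparison)
      show "((\<lambda>s. norm_L1w (\<lambda>x. (u s x - u t x) / (s - t) - v t x)) \<longlongrightarrow> 0) (at t)"
      proof -
        have "((\<lambda>s. norm_L1w (\<lambda>x. (u s x - u t x) / (s - t) - v t x)) \<longlongrightarrow> 0) (at t within {0<..})"
          using der t by (auto simp: has_deriv_L1w_def)
        moreover have "at t within {0<..} = at t" using t by (intro at_within_open) auto
        ultimately show ?thesis by (simp only:)
      qed
      have "(LINT x|lborel. \<bar>(log_profile (u s) x - log_profile (u t) x) / (s - t)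
          - (convolution (log_size_law k) (log_profile (u t)) x - log_profile (u t) x)\<bar>)
          \<le> norm_L1w (\<lambda>x. (u s x - u t x) / (s - t) - v t x)" if s: "s > 0" for s
      proof -
        have W: "in_L1w (\<lambda>x. (u s x - u t x) / (s - t) - v t x)"
          using s t by (intro in_L1w_diff in_L1w_divide L Lv) auto
        have [measurable]: "log_profile (u s) \<in> borel_measurable borel" "log_profile (u t) \<in> borel_measurable borel"
          "convolution (log_size_law k) (log_profile (u t)) \<in> borel_measurable borel"
          "log_profile (\<lambda>x. (u s x - u t x) / (s - t) - v t x) \<in> borel_measurable borel"
          using s t integrable_log_profile[OF L, of s] integrable_log_profile[OF L, of t]
            integrable_convolution_real[OF integrable_log_profile[OF L, of t]] integrable_log_profile[OF W]
          by auto
        have "(LINT x|lborel. \<bar>(log_profile (u s) x - log_profile (u t) x) / (s - t)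
          - (convolution (log_size_law k) (log_profile (u t)) x - log_profile (u t) x)\<bar>)
          = (LINT x|lborel. \<bar>log_profile (\<lambda>x. (u s x - u t x) / (s - t) - v t x) x\<bar>)"
        proof (rule integral_cong_AE)
          show "AE x in lborel. \<bar>(log_profile (u s) x - log_profile (u t) x) / (s - t)
            - (convolution (log_size_law k) (log_profile (u t)) x - log_profile (u t) x)\<bar>
            = \<bar>log_profile (\<lambda>x. (u s x - u t x) / (s - t) - v t x) x\<bar>"
            using eq'
          proof eventually_elim
            case (elim x)
            then show ?case unfolding elim[symmetric]
              by (simp add: log_profile_def right_diff_distrib)
          qed
        qed measurable
        also have "\<dots> \<le> norm_L1w (\<lambda>x. (u s x - u t x) / (s - t) - v t x)"
          by (rule integral_abs_log_profile_le[OF W])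
        finally show ?thesis .
      qed
      moreover have "\<forall>\<^sub>F s in at t. s > 0"
        using t by (intro order_tendstoD[OF tendsto_ident_at])
      ultimately show "\<forall>\<^sub>F s in at t. norm (LINT x|lborel. \<bar>(log_profile (u s) x - log_profile (u t) x) / (s - t)
          - (convolution (log_size_law k) (log_profile (u t)) x - log_profile (u t) x)\<bar>)
          \<le> norm_L1w (\<lambda>x. (u s x - u t x) / (s - t) - v t x)"
        by (auto elim!: eventually_mono simp: abs_of_nonneg integral_nonneg_AE)
    qed
  next
    show "AE x in lborel. 0 \<le> log_profile (u 0) x"
      using AE_exp_substitution[OF init] by eventually_elim (simp add: log_profile_def u0)
  qed
qed

section \<open>Limits of the rescaled solutions\<close>

lemma integral_rescaled:
  assumes "t > 0"
  shows "(LBINT y. \<phi> y * rescaled u t y) = (LINT x|lborel. \<phi> (x / t) * log_profile (u t) x)"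
proof -
  have "(LINT x|lborel. \<phi> (x / t) * log_profile (u t) x)
      = t * (LINT y|lborel. \<phi> y * log_profile (u t) (t * y))"
    using lborel_integral_real_affine[of t "\<lambda>x. \<phi> (x / t) * log_profile (u t) x" 0] assms by simp
  also have "\<dots> = (LINT y|lborel. t * (\<phi> y * log_profile (u t) (t * y)))" by simp
  also have "\<dots> = (LBINT y. \<phi> y * rescaled u t y)"
    by (intro Bochner_Integration.integral_cong) (simp_all add: rescaled_def log_profile_def mult_ac)
  finally show ?thesis by simp
qed

lemma integral_rescaled_gauss:
  assumes t: "t > 0" and \<sigma>: "\<sigma> > 0"
  shows "(LBINT z. \<phi> z * rescaled_gauss u y0 \<sigma> t z)
    = (LINT x|lborel. \<phi> ((x - t * y0) / (\<sigma> * sqrt t)) * log_profile (u t) x)"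
proof -
  have s: "\<sigma> * sqrt t > 0" "\<sigma> * sqrt t \<noteq> 0" using assms by auto
  have scale: "t * (\<sigma> / sqrt t) = \<sigma> * sqrt t"
    using t by (simp add: field_simps)
  have arg: "t * (y0 + \<sigma> * z / sqrt t) = t * y0 + \<sigma> * sqrt t * z" for z
    using t by (simp add: field_simps)
  have "(LINT x|lborel. \<phi> ((x - t * y0) / (\<sigma> * sqrt t)) * log_profile (u t) x)
      = (\<sigma> * sqrt t) * (LINT z|lborel. \<phi> z * log_profile (u t) (t * y0 + \<sigma> * sqrt t * z))"
    using lborel_integral_real_affine[of "\<sigma> * sqrt t" "\<lambda>x. \<phi> ((x - t * y0) / (\<sigma> * sqrt t)) * log_profile (u t) x" "t * y0"] s
    by simp
  also have "\<dots> = (LINT z|lborel. (\<sigma> * sqrt t) * (\<phi> z * log_profile (u t) (t * y0 + \<sigma> * sqrt t * z)))" by simp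
  also have "\<dots> = (LBINT z. \<phi> z * rescaled_gauss u y0 \<sigma> t z)"
  proof (rule Bochner_Integration.integral_cong[OF refl])
    fix z
    have "rescaled_gauss u y0 \<sigma> t z = t * (\<sigma> / sqrt t) * log_profile (u t) (t * (y0 + \<sigma> * z / sqrt t))"
      by (simp add: rescaled_gauss_def rescaled_def log_profile_def mult_ac)
    then show "\<sigma> * sqrt t * (\<phi> z * log_profile (u t) (t * y0 + \<sigma> * sqrt t * z)) = \<phi> z * rescaled_gauss u y0 \<sigma> t z"
      by (simp only: scale arg mult_ac)
  qed
  finally show ?thesis by simp
qed

theorem corollary1:
  fixes k0 :: "real measure"
    and u0 u0' u0'' :: "real \<Rightarrow> real"
    and u :: "real \<Rightarrow> real \<Rightarrow> real"
    and y0 \<sigma> :: real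
  assumes kernel: "fragmentation_kernel k0"
    and kernel_type: "has_nonzero_ac_part k0 \<or>
      (discrete_measure k0 \<and> 1 \<notin> atoms k0 \<and> \<not> condition_H (atoms k0))"
    and u0_nonneg: "\<And>x. x > 0 \<Longrightarrow> u0 x \<ge> 0"
    and u0_integrable: "set_integrable lborel {0<..} (\<lambda>x. u0 x * (1 + x))"
    and u0_deriv: "loc_abs_cont_deriv u0 u0'"
    and u0_deriv2: "loc_abs_cont_deriv u0' u0''"
    and u0_moments: "\<And>\<nu>. lower_exponent u0 < ereal \<nu> \<Longrightarrow> ereal \<nu> < upper_exponent u0 \<Longrightarrow>
      set_integrable lborel {0<..} (\<lambda>x. \<bar>u0' x\<bar> * x powr \<nu>) \<and>
      ((\<lambda>x. x powr \<nu> * u0 x) \<longlongrightarrow> 0) (at_right 0) \<and>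
      ((\<lambda>x. x powr \<nu> * u0 x) \<longlongrightarrow> 0) at_top \<and>
      set_integrable lborel {0<..} (\<lambda>x. \<bar>u0'' x\<bar> * x powr (1 + \<nu>)) \<and>
      ((\<lambda>x. x powr (1 + \<nu>) * u0' x) \<longlongrightarrow> 0) (at_right 0) \<and>
      ((\<lambda>x. x powr (1 + \<nu>) * u0' x) \<longlongrightarrow> 0) at_top"
    and u0_at_infinity: "\<And>q0. upper_exponent u0 = ereal q0 \<Longrightarrow>
      \<exists>a0 r C1 C2. a0 > 0 \<and> r > q0 \<and> C1 > 0 \<and> C2 > 0 \<and>
        (\<forall>x>1. \<bar>u0 x - a0 * x powr (- q0)\<bar> \<le> C1 * x powr (- r)) \<and>
        (\<forall>x>1. \<bar>u0' x + a0 * q0 * x powr (- q0 - 1)\<bar> \<le> C2 * x powr (- r - 1)) \<and>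
        (\<forall>\<nu>\<in>{q0<..<r}. set_integrable lborel {1<..}
          (\<lambda>x. x powr (\<nu> + 1) * \<bar>u0'' x - a0 * q0 * (q0 + 1) * x powr (- q0 - 2)\<bar>))"
    and u0_at_zero: "\<And>p0. lower_exponent u0 = ereal p0 \<Longrightarrow>
      \<exists>b0 \<rho> C1 C2. b0 > 0 \<and> \<rho> < p0 \<and> C1 > 0 \<and> C2 > 0 \<and>
        (\<forall>x\<in>{0<..<1}. \<bar>u0 x - b0 * x powr (- p0)\<bar> \<le> C1 * x powr (- \<rho>)) \<and>
        (\<forall>x\<in>{0<..<1}. \<bar>u0' x + b0 * p0 * x powr (- p0 - 1)\<bar> \<le> C2 * x powr (- \<rho> - 1)) \<and>
        (\<forall>\<nu>\<in>{\<rho><..<p0}. set_integrable lborel {0<..<1}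
          (\<lambda>x. x powr (\<nu> + 1) * \<bar>u0'' x - b0 * p0 * (p0 + 1) * x powr (- p0 - 2)\<bar>))"
    and solution: "fragmentation_solution k0 u0 u"
    and y0: "y0 = deriv (kernel_mellin k0) 2"
    and sigma: "\<sigma> > 0" "\<sigma>\<^sup>2 = deriv (deriv (kernel_mellin k0)) 2"
  shows "mellin u0 2 = (LBINT x:{0<..}. x * u0 x) \<and>
    (\<forall>\<phi>::real \<Rightarrow> real. continuous_on UNIV \<phi> \<and> bounded (range \<phi>) \<longrightarrow>
      ((\<lambda>t. LBINT y. \<phi> y * rescaled u t y)
         \<longlongrightarrow> mellin u0 2 * \<phi> (deriv (kernel_mellin k0) 2)) at_top \<and>
      ((\<lambda>t. LBINT z. \<phi> z * rescaled_gauss u y0 \<sigma> t z)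
         \<longlongrightarrow> mellin u0 2 * (LBINT z. \<phi> z * (exp (- z\<^sup>2 / 2) / sqrt (2 * pi)))) at_top)"
proof (intro conjI allI impI)
  have L0: "in_L1w u0" using u0_integrable by (simp add: in_L1w_def)
  then show "mellin u0 2 = (LBINT x:{0<..}. x * u0 x)"
    by (rule mellin_2_eq_integral_log_profile(2))
  interpret convolution_flow_exp_moments "log_size_law k0" "\<lambda>t. log_profile (u t)" "1/2"
    by (rule convolution_flow_log_profile[OF kernel u0_nonneg solution])
  have "AE x in lborel. log_profile (u 0) x = log_profile u0 x"
    using AE_exp_substitution[of "\<lambda>x. u 0 x = u0 x"] solution
    by (simp add: fragmentation_solution_def log_profile_def)
  then have "(LINT x|lborel. log_profile (u 0) x) = (LINT x|lborel. log_profile u0 x)"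
    using integrable_flow[of 0] integrable_log_profile[OF L0] by (intro integral_cong_AE) auto
  then have mass: "(LINT x|lborel. log_profile (u 0) x) = mellin u0 2"
    using mellin_2_eq_integral_log_profile(1)[OF L0] by simp
  fix \<phi> :: "real \<Rightarrow> real" assume \<phi>: "continuous_on UNIV \<phi> \<and> bounded (range \<phi>)"
  then have \<phi>1: "continuous_on UNIV \<phi>" and \<phi>2: "bounded (range \<phi>)" by auto
  have "((\<lambda>t. LINT x|lborel. \<phi> (x / t) * log_profile (u t) x)
      \<longlongrightarrow> mellin u0 2 * \<phi> (deriv (kernel_mellin k0) 2)) at_top"
    using law_of_large_numbers[OF \<phi>1 \<phi>2] unfolding mass deriv_kernel_mellin[OF kernel] .
  moreover have "\<forall>\<^sub>F t in at_top. (LINT x|lborel. \<phi> (x / t) * log_profile (u t) x) = (LBINT y. \<phi> y * rescaled u t y)"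
    using eventually_gt_at_top[of 0] by eventually_elim (rule integral_rescaled[symmetric])
  ultimately show "((\<lambda>t. LBINT y. \<phi> y * rescaled u t y)
      \<longlongrightarrow> mellin u0 2 * \<phi> (deriv (kernel_mellin k0) 2)) at_top"
    by (rule Lim_transform_eventually)
  have [measurable]: "\<phi> \<in> borel_measurable borel"
    using \<phi>1 by (rule borel_measurable_continuous_onI)
  have gauss: "(LINT z|std_normal_distribution. \<phi> z) = (LBINT z. \<phi> z * (exp (- z\<^sup>2 / 2) / sqrt (2 * pi)))"
    by (subst integral_density) (auto simp: std_normal_density_def mult_ac)
  have sigma2: "\<sigma>\<^sup>2 = (LINT x|log_size_law k0. x\<^sup>2)"
    unfolding sigma(2) by (rule deriv2_kernel_mellin[OF kernel])
  have mean: "(LINT x|log_size_law k0. x) = y0"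
    unfolding y0 by (rule deriv_kernel_mellin[OF kernel, symmetric])
  have "((\<lambda>t. LINT x|lborel. \<phi> ((x - t * y0) / (\<sigma> * sqrt t)) * log_profile (u t) x)
      \<longlongrightarrow> mellin u0 2 * (LBINT z. \<phi> z * (exp (- z\<^sup>2 / 2) / sqrt (2 * pi)))) at_top"
    using central_limit[OF \<phi>1 \<phi>2 sigma(1) sigma2] unfolding mean mass gauss .
  moreover have "\<forall>\<^sub>F t in at_top. (LINT x|lborel. \<phi> ((x - t * y0) / (\<sigma> * sqrt t)) * log_profile (u t) x)
      = (LBINT z. \<phi> z * rescaled_gauss u y0 \<sigma> t z)"
    using eventually_gt_at_top[of 0]
    by eventually_elim (rule integral_rescaled_gauss[OF _ sigma(1), symmetric])
  ultimately show "((\<lambda>t. LBINT z. \<phi> z * rescaled_gauss u y0 \<sigma> t z)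
      \<longlongrightarrow> mellin u0 2 * (LBINT z. \<phi> z * (exp (- z\<^sup>2 / 2) / sqrt (2 * pi)))) at_top"
    by (rule Lim_transform_eventually)
qed

end
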